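(* Let $A_i,B_i\in\mathcal{B}(\mathcal{H})$ $(1\leq i\leq n)$ be positive invertible operators on a complex Hilbert space $\mathcal{H}$, let $t\in[0,1]$, and put $r=\min\{t,1-t\}$, $R=\max\{t,1-t\}$, $r_{0}=\min\{2r,1-2r\}$. (i) If $0<t\leq\frac12$, then $$\begin{aligned}\Big(\sum_{i=1}^{n}A_{i}\Big)\sharp_{t}\Big(\sum_{i=1}^{n}B_{i}\Big)-\sum_{i=1}^{n}(A_{i}\sharp_{t}B_{i})\le{}&R\Big(\sum_{i=1}^{n}A_{i}+\sum_{i=1}^{n}B_{i}-2\sum_{i=1}^{n}(A_{i}\sharp B_{i})\Big)\\&-r_{0}\Big(\sum_{i=1}^{n}(A_{i}\sharp B_{i})+\sum_{i=1}^{n}B_{i}-2\sum_{i=1}^{n}(A_{i}\sharp_{\frac34}B_{i})\Big)\\&-r_{0}\Big(\Big(\sum_{i=1}^{n}A_{i}\Big)\sharp\Big(\sum_{i=1}^{n}B_{i}\Big)+\sum_{i=1}^{n}A_{i}-2\Big(\sum_{i=1}^{n}A_{i}\Big)\sharp_{\frac14}\Big(\sum_{i=1}^{n}B_{i}\Big)\Big).\end{aligned}$$ (ii) If $\frac12<t<1$, then $$\begin{aligned}\Big(\sum_{i=1}^{n}A_{i}\Big)\sharp_{t}\Big(\sum_{i=1}^{n}B_{i}\Big)-\sum_{i=1}^{n}(A_{i}\sharp_{t}B_{i})\le{}&R\Big(\sum_{i=1}^{n}A_{i}+\sum_{i=1}^{n}B_{i}-2\sum_{i=1}^{n}(A_{i}\sharp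 B_{i})\Big)\\&-r_{0}\Big(\Big(\sum_{i=1}^{n}A_{i}\Big)\sharp\Big(\sum_{i=1}^{n}B_{i}\Big)+\sum_{i=1}^{n}B_{i}-2\Big(\sum_{i=1}^{n}A_{i}\Big)\sharp_{\frac34}\Big(\sum_{i=1}^{n}B_{i}\Big)\Big)\\&-r_{0}\Big(\sum_{i=1}^{n}(A_{i}\sharp B_{i})+\sum_{i=1}^{n}A_{i}-2\sum_{i=1}^{n}(A_{i}\sharp_{\frac14}B_{i})\Big).\end{aligned}$$
   Context: $\mathcal{B}(\mathcal{H})$ is the $C^*$-algebra of bounded linear operators on $\mathcal{H}$; $X\le Y$ means $Y-X$ is positive. For positive invertible $A,B$ and $u\in[0,1]$, $A\sharp_{u}B=A^{1/2}(A^{-1/2}BA^{-1/2})^{u}A^{1/2}$, and $A\sharp B=A\sharp_{1/2}B$. *)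

theory Defs
  imports "HOL-Analysis.Analysis" "HOL-Computational_Algebra.Polynomial"
begin

text \<open>
  Complex Hilbert spaces: the inner product is conjugate-linear in the first and linear in the
  second argument. Positive definiteness is part of the axiom \<open>cinner_self\<close>, because
  the norm is one already. The zero space is included.
\<close>

class chilbert_space = banach +
  fixes scaleC :: "complex \<Rightarrow> 'a \<Rightarrow> 'a" (infixr "*\<^sub>C" 75)
    and cinner :: "'a \<Rightarrow> 'a \<Rightarrow> complex"
  assumes scaleC_of_real: "complex_of_real s *\<^sub>C x = s *\<^sub>R x"
    and scaleC_add_right: "c *\<^sub>C (x + y) = c *\<^sub>C x + c *\<^sub>C y"
    and scaleC_add_left: "(c + d) *\<^sub>C x = c *\<^sub>C x + d *\<^sub>C x"
    and scaleC_scaleC: "c *\<^sub>C (d *\<^sub>C x) = (c * d) *\<^sub>C x"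
    and cinner_commute: "cinner x y = cnj (cinner y x)"
    and cinner_add_right: "cinner x (y + z) = cinner x y + cinner x z"
    and cinner_scaleC_right: "cinner x (c *\<^sub>C y) = c * cinner x y"
    and cinner_self: "cinner x x = complex_of_real ((norm x)\<^sup>2)"

instantiation complex :: chilbert_space
begin

definition scaleC_complex :: "complex \<Rightarrow> complex \<Rightarrow> complex"
  where "scaleC_complex c x = c * x"

definition cinner_complex :: "complex \<Rightarrow> complex \<Rightarrow> complex"
  where "cinner_complex x y = cnj x * y"

instance
  by standard
    (simp_all add: scaleC_complex_def cinner_complex_def scaleR_conv_of_real algebra_simps
      complex_norm_square del: of_real_power)

end

lemma norm_scaleC: "norm (c *\<^sub>C x) = cmod c * norm x"
  for x :: "'a::chilbert_space"
proof -
  have "cinner (c *\<^sub>C x) (c *\<^sub>C x) = c * cnj (cinner x (c *\<^sub>C x))"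
    by (metis cinner_commute cinner_scaleC_right)
  also have "\<dots> = complex_of_real ((cmod c * norm x)\<^sup>2)"
    by (simp add: cinner_scaleC_right cinner_self power_mult_distrib flip: complex_norm_square)
  finally have "(norm (c *\<^sub>C x))\<^sup>2 = (cmod c * norm x)\<^sup>2"
    by (simp only: cinner_self of_real_eq_iff)
  then show ?thesis
    by (simp add: power2_eq_iff_nonneg)
qed

lift_definition scalar_op :: "complex \<Rightarrow> 'a::chilbert_space \<Rightarrow>\<^sub>L 'a"
  is "\<lambda>c x. c *\<^sub>C x"
proof (rule bounded_linear_intro)
  fix c :: complex and s :: real and x y :: 'a
  show "c *\<^sub>C (x + y) = c *\<^sub>C x + c *\<^sub>C y"
    by (rule scaleC_add_right)
  show "c *\<^sub>C (s *\<^sub>R x) = s *\<^sub>R (c *\<^sub>C x)"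
    by (metis mult.commute scaleC_of_real scaleC_scaleC)
  show "norm (c *\<^sub>C x) \<le> norm x * cmod c"
    by (simp add: norm_scaleC mult.commute)
qed

text \<open>
  The type of bounded linear functions is that of real-linear ones;
  \<open>bounded_ops\<close> is the algebra of complex-linear bounded operators.
\<close>

definition bounded_ops :: "('a::chilbert_space \<Rightarrow>\<^sub>L 'a) set"
  where "bounded_ops = {T. \<forall>c x. blinfun_apply T (c *\<^sub>C x) = c *\<^sub>C blinfun_apply T x}"

definition positive_op :: "('a::chilbert_space \<Rightarrow>\<^sub>L 'a) \<Rightarrow> bool"
  where "positive_op T \<longleftrightarrow> T \<in> bounded_ops \<and> (\<forall>x. cinner x (blinfun_apply T x) \<in> \<real>\<^sub>\<ge>\<^sub>0)"

definition op_le :: "('a::chilbert_space \<Rightarrow>\<^sub>L 'a) \<Rightarrow> ('a \<Rightarrow>\<^sub>L 'a) \<Rightarrow> bool"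
    (infix "\<le>\<^sub>o\<^sub>p" 50)
  where "X \<le>\<^sub>o\<^sub>p Y \<longleftrightarrow> positive_op (Y - X)"

definition invertible_op :: "('a::chilbert_space \<Rightarrow>\<^sub>L 'a) \<Rightarrow> bool"
  where "invertible_op T \<longleftrightarrow>
    (\<exists>S\<in>bounded_ops. S o\<^sub>L T = id_blinfun \<and> T o\<^sub>L S = id_blinfun)"

definition op_spectrum :: "('a::chilbert_space \<Rightarrow>\<^sub>L 'a) \<Rightarrow> complex set"
  where "op_spectrum T = {z. \<not> invertible_op (T - scalar_op z)}"

definition op_poly :: "real poly \<Rightarrow> ('a::chilbert_space \<Rightarrow>\<^sub>L 'a) \<Rightarrow> ('a \<Rightarrow>\<^sub>L 'a)"
  where "op_poly p T = (\<Sum>i\<le>degree p. coeff p i *\<^sub>R (((o\<^sub>L) T ^^ i) id_blinfun))"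

text \<open>
  Continuous functional calculus \<open>f(T)\<close> of a self-adjoint operator \<open>T\<close>, for a
  real function \<open>f\<close> continuous on the spectrum of \<open>T\<close>, which is then a
  compact set of real numbers: \<open>f(T)\<close> is the norm limit of \<open>p k (T)\<close> for
  polynomials \<open>p k\<close> converging to \<open>f\<close> uniformly on the spectrum.
\<close>

definition cfc :: "(real \<Rightarrow> real) \<Rightarrow> ('a::chilbert_space \<Rightarrow>\<^sub>L 'a) \<Rightarrow> ('a \<Rightarrow>\<^sub>L 'a)"
  where "cfc f T = (THE S. \<forall>p :: nat \<Rightarrow> real poly.
    uniform_limit {x. complex_of_real x \<in> op_spectrum T} (\<lambda>k x. poly (p k) x) f sequentially
      \<longrightarrow> (\<lambda>k. op_poly (p k) T) \<longlonglongrightarrow> S)"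

text \<open>
  Meant for positive invertible \<open>T\<close>, whose spectrum consists of positive reals. There
  \<open>x powr u\<close> is the usual power for every real \<open>u\<close>; in particular
  \<open>0 powr 0 = 0\<close> plays no role.
\<close>

definition op_powr :: "('a::chilbert_space \<Rightarrow>\<^sub>L 'a) \<Rightarrow> real \<Rightarrow> ('a \<Rightarrow>\<^sub>L 'a)"
  where "op_powr T u = cfc (\<lambda>x. x powr u) T"

definition geo_mean :: "('a::chilbert_space \<Rightarrow>\<^sub>L 'a) \<Rightarrow> real \<Rightarrow> ('a \<Rightarrow>\<^sub>L 'a) \<Rightarrow> ('a \<Rightarrow>\<^sub>L 'a)"
    ("(_ \<sharp>\<^bsub>_\<^esub> _)" [71, 0, 71] 70)
  where "A \<sharp>\<^bsub>u\<^esub> B =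
    op_powr A (1/2) o\<^sub>L op_powr (op_powr A (-1/2) o\<^sub>L B o\<^sub>L op_powr A (-1/2)) u o\<^sub>L op_powr A (1/2)"

abbreviation geo_mean_half :: "('a::chilbert_space \<Rightarrow>\<^sub>L 'a) \<Rightarrow> ('a \<Rightarrow>\<^sub>L 'a) \<Rightarrow> ('a \<Rightarrow>\<^sub>L 'a)"
    (infix "\<sharp>" 70)
  where "A \<sharp> B \<equiv> A \<sharp>\<^bsub>1/2\<^esub> B"

end

theory Submission
  imports Defs "HOL-Computational_Algebra.Fundamental_Theorem_Algebra"
begin

text \<open>
  No joint concavity of the mean is needed. The refined Young inequality bounds \<open>S \<sharp>\<^sub>t S'\<close> for
  the two sums \<open>S = \<Sum>A\<^sub>i\<close>, \<open>S' = \<Sum>B\<^sub>i\<close> from above by the arithmetic mean \<open>(1 - t) S + t S'\<close>,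
  its reverse bounds each \<open>A\<^sub>i \<sharp>\<^sub>t B\<^sub>i\<close> from below, and the arithmetic means cancel on summation.
  Both are inequalities between powers of a number \<open>x > 0\<close>; they pass to \<open>A\<^sup>-\<^sup>1\<^sup>/\<^sup>2 B A\<^sup>-\<^sup>1\<^sup>/\<^sup>2\<close>
  by the functional calculus, and to the means on conjugating with \<open>A\<^sup>1\<^sup>/\<^sup>2\<close>.

  The functional calculus rests on \<open>\<parallel>p(T)\<parallel> \<le> sup \<bar>p\<bar>\<close>, the supremum being over the spectrum of the
  self-adjoint operator \<open>T\<close>. Factoring \<open>p\<close> over the complex numbers shows that \<open>p(T)\<close> is
  invertible unless \<open>p\<close> has a zero on the spectrum, and that is applied to \<open>\<parallel>p(T)\<parallel>\<^sup>2 - p\<^sup>2\<close>.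
\<close>

subsection \<open>Self-adjoint and positive operators\<close>

lemma cinner_scaleR_right: "cinner x (s *\<^sub>R y) = of_real s * cinner x y"
  by (metis cinner_scaleC_right scaleC_of_real)

lemma linear_cinner: "linear (cinner x)"
  by (rule linearI) (simp_all add: cinner_add_right cinner_scaleR_right scaleR_conv_of_real)

lemmas cinner_diff_right = linear_diff[OF linear_cinner]
  and cinner_minus_right = linear_neg[OF linear_cinner]

lemma Re_cinner_commute: "Re (cinner x y) = Re (cinner y x)"
  by (subst cinner_commute) simp

lemma cinner_add_left: "cinner (x + y) z = cinner x z + cinner y z"
  by (metis cinner_add_right cinner_commute complex_cnj_add)

lemma cinner_scaleC_left: "cinner (c *\<^sub>C x) y = cnj c * cinner x y"
  by (metis cinner_commute cinner_scaleC_right complex_cnj_mult)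

lemma norm_add_power2: "(norm (x + y))\<^sup>2 = (norm x)\<^sup>2 + 2 * Re (cinner x y) + (norm y)\<^sup>2"
  for x y :: "'a::chilbert_space"
proof -
  have "complex_of_real ((norm (x + y))\<^sup>2) = cinner x x + cinner x y + (cinner y x + cinner y y)"
    by (simp add: cinner_add_left cinner_add_right flip: cinner_self del: of_real_power)
  then have "Re (complex_of_real ((norm (x + y))\<^sup>2)) = Re (cinner x x + cinner x y + (cinner y x + cinner y y))"
    by simp
  then show ?thesis
    by (simp add: cinner_self Re_cinner_commute[of y x] del: of_real_power)
qed

lemma Re_cinner_self: "Re (cinner x x) = (norm x)\<^sup>2"
  by (simp add: cinner_self del: of_real_power)

text \<open>Since the norm is already known to satisfy the triangle inequality, Cauchy-Schwarz
  follows by squaring it and comparing the cross terms.\<close>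

lemma Re_cinner_le: "Re (cinner x y) \<le> norm x * norm y"
proof -
  have "(norm (x + y))\<^sup>2 \<le> (norm x + norm y)\<^sup>2"
    by (simp add: norm_triangle_ineq power_mono)
  then show ?thesis
    by (simp add: norm_add_power2 power2_sum)
qed

text \<open>Written through norms alone, the real part inherits continuity in both arguments from
  the norm.\<close>

lemma Re_cinner_polarization:
  "Re (cinner x y) = ((norm (x + y))\<^sup>2 - (norm x)\<^sup>2 - (norm y)\<^sup>2) / 2"
  by (simp add: norm_add_power2)

lemma tendsto_Re_cinner:
  assumes "(f \<longlongrightarrow> x) F" "(g \<longlongrightarrow> y) F"
  shows "((\<lambda>k. Re (cinner (f k) (g k))) \<longlongrightarrow> Re (cinner x y)) F"
  unfolding Re_cinner_polarization by (intro tendsto_intros assms) simp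

lemma scaleC_scaleR: "c *\<^sub>C (s *\<^sub>R x) = s *\<^sub>R (c *\<^sub>C x)"
  by (metis mult.commute scaleC_of_real scaleC_scaleC)

lemma scaleC_one: "1 *\<^sub>C x = x"
  by (metis of_real_1 scaleC_of_real scaleR_one)

section \<open>The algebra of complex-linear bounded operators and its invertible elements\<close>

interpretation blinfun_compose: bounded_bilinear "(o\<^sub>L)"
  by (rule bounded_bilinear_blinfun_compose)

lemma bounded_opsI: "(\<And>c x. blinfun_apply T (c *\<^sub>C x) = c *\<^sub>C blinfun_apply T x) \<Longrightarrow> T \<in> bounded_ops"
  by (simp add: bounded_ops_def)

lemma bounded_opsD: "T \<in> bounded_ops \<Longrightarrow> blinfun_apply T (c *\<^sub>C x) = c *\<^sub>C blinfun_apply T x"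
  by (simp add: bounded_ops_def)

lemma scaleC_diff_right: "c *\<^sub>C (x - y) = c *\<^sub>C x - c *\<^sub>C y"
  using scaleC_add_right[of c "x - y" y] by simp

lemma bounded_ops_id: "id_blinfun \<in> bounded_ops"
  by (rule bounded_opsI) simp

lemma bounded_ops_scalar_op: "scalar_op c \<in> bounded_ops"
  by (rule bounded_opsI) (simp add: scalar_op.rep_eq scaleC_scaleC mult.commute)

lemma bounded_ops_add: "S \<in> bounded_ops \<Longrightarrow> T \<in> bounded_ops \<Longrightarrow> S + T \<in> bounded_ops"
  by (rule bounded_opsI) (simp add: blinfun.add_left bounded_opsD scaleC_add_right)

lemma bounded_ops_diff: "S \<in> bounded_ops \<Longrightarrow> T \<in> bounded_ops \<Longrightarrow> S - T \<in> bounded_ops"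
  by (rule bounded_opsI) (simp add: blinfun.diff_left bounded_opsD scaleC_diff_right)

lemma bounded_ops_scaleR: "T \<in> bounded_ops \<Longrightarrow> s *\<^sub>R T \<in> bounded_ops"
  by (rule bounded_opsI) (simp add: blinfun.scaleR_left bounded_opsD scaleC_scaleR)

lemma bounded_ops_compose: "S \<in> bounded_ops \<Longrightarrow> T \<in> bounded_ops \<Longrightarrow> S o\<^sub>L T \<in> bounded_ops"
  by (rule bounded_opsI) (simp add: bounded_opsD)

lemma blinfun_compose_assoc: "(R o\<^sub>L S) o\<^sub>L T = R o\<^sub>L (S o\<^sub>L T)"
  by (simp add: blinfun_eqI)

lemma blinfun_compose_id: "T o\<^sub>L id_blinfun = T" "id_blinfun o\<^sub>L T = T"
  by (simp_all add: blinfun_eqI)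

text \<open>Complex linearity passes to a two-sided inverse, so an inverse may be built by
  real-linear means, as with the Neumann series below.\<close>

lemma bounded_ops_inverse:
  assumes T: "T \<in> bounded_ops" and "S o\<^sub>L T = id_blinfun" "T o\<^sub>L S = id_blinfun"
  shows "S \<in> bounded_ops"
proof (rule bounded_opsI)
  fix c x
  have TS: "blinfun_apply T (blinfun_apply S y) = y" and ST: "blinfun_apply S (blinfun_apply T y) = y" for y
    using assms(2,3) by (metis blinfun_apply_blinfun_compose blinfun_apply_id_blinfun id_apply)+
  show "blinfun_apply S (c *\<^sub>C x) = c *\<^sub>C blinfun_apply S x"
    by (metis ST TS bounded_opsD[OF T])
qed

lemma invertible_opI:
  assumes "T \<in> bounded_ops" "S o\<^sub>L T = id_blinfun" "T o\<^sub>L S = id_blinfun"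
  shows "invertible_op T"
  using assms bounded_ops_inverse unfolding invertible_op_def by blast

lemma invertible_op_compose:
  assumes "invertible_op S" "invertible_op T"
  shows "invertible_op (S o\<^sub>L T)"
proof -
  obtain S' T' where S': "S' \<in> bounded_ops" "S' o\<^sub>L S = id_blinfun" "S o\<^sub>L S' = id_blinfun"
    and T': "T' \<in> bounded_ops" "T' o\<^sub>L T = id_blinfun" "T o\<^sub>L T' = id_blinfun"
    using assms unfolding invertible_op_def by blast
  have "(T' o\<^sub>L S') o\<^sub>L (S o\<^sub>L T) = T' o\<^sub>L (S' o\<^sub>L S) o\<^sub>L T"
    and "(S o\<^sub>L T) o\<^sub>L (T' o\<^sub>L S') = S o\<^sub>L (T o\<^sub>L T') o\<^sub>L S'"
    by (simp_all only: blinfun_compose_assoc)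
  with S' T' show ?thesis
    unfolding invertible_op_def
    by (auto intro!: bexI[of _ "T' o\<^sub>L S'"] bounded_ops_compose simp: blinfun_compose_id)
qed

lemma invertible_scalar_op:
  assumes "c \<noteq> 0"
  shows "invertible_op (scalar_op c)"
  by (rule invertible_opI[of _ "scalar_op (inverse c)"])
    (use assms in \<open>auto intro!: blinfun_eqI bounded_ops_scalar_op
      simp: scalar_op.rep_eq scaleC_scaleC scaleC_one\<close>)

text \<open>Comparing real parts is enough: by complex linearity, replacing \<open>y\<close> by
  \<open>\<i> *\<^sub>C y\<close> gives the same identity for imaginary parts.\<close>

definition selfadj :: "('a::chilbert_space \<Rightarrow>\<^sub>L 'a) \<Rightarrow> bool"
  where "selfadj T \<longleftrightarrow> T \<in> bounded_ops \<and> (\<forall>x y. Re (cinner x (T y)) = Re (cinner (T x) y))"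

lemma selfadj_bounded_ops: "selfadj T \<Longrightarrow> T \<in> bounded_ops"
  by (simp add: selfadj_def)

lemma selfadjD: "selfadj T \<Longrightarrow> Re (cinner x (T y)) = Re (cinner (T x) y)"
  by (simp add: selfadj_def)

lemma selfadj_Im:
  assumes "selfadj T"
  shows "Im (cinner x (T x)) = 0"
proof -
  have "Re (cinner x (T (\<i> *\<^sub>C x))) = Re (cinner (T x) (\<i> *\<^sub>C x))"
    by (rule selfadjD[OF assms])
  then have "Im (cinner x (T x)) = Im (cinner (T x) x)"
    by (simp add: cinner_scaleC_right bounded_opsD[OF selfadj_bounded_ops[OF assms]])
  moreover have "Im (cinner (T x) x) = - Im (cinner x (T x))"
    by (subst cinner_commute) simp
  ultimately show ?thesis by simp
qed

text \<open>Over the complex numbers a form that is real on the diagonal is Hermitian.\<close>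

lemma positive_op_iff: "positive_op T \<longleftrightarrow> selfadj T \<and> (\<forall>x. 0 \<le> Re (cinner x (T x)))"
proof
  assume *: "positive_op T"
  then have T: "T \<in> bounded_ops" and pos: "\<And>x. cinner x (T x) \<in> \<real>\<^sub>\<ge>\<^sub>0"
    by (auto simp: positive_op_def)
  have im: "Im (cinner x (T x)) = 0" and re: "0 \<le> Re (cinner x (T x))" for x
    using pos[of x] by (auto simp: complex_nonneg_Reals_iff)
  have "Re (cinner x (T y)) = Re (cinner (T x) y)" for x y
  proof -
    \<comment> \<open>Polarization at \<open>x + \<i> *\<^sub>C y\<close>: the diagonal terms are
      real, so only the cross terms contribute to the imaginary part, which itself vanishes.\<close>
    have "Im (cinner (x + \<i> *\<^sub>C y) (T (x + \<i> *\<^sub>C y))) = Re (cinner x (T y)) - Re (cinner y (T x))"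
      using im[of x] im[of y]
      by (simp add: blinfun.add_right bounded_opsD[OF T] cinner_add_left cinner_add_right
          cinner_scaleC_left cinner_scaleC_right)
    then show ?thesis
      by (simp add: im Re_cinner_commute[of y])
  qed
  with T re show "selfadj T \<and> (\<forall>x. 0 \<le> Re (cinner x (T x)))"
    by (simp add: selfadj_def)
next
  assume "selfadj T \<and> (\<forall>x. 0 \<le> Re (cinner x (T x)))"
  then show "positive_op T"
    by (simp add: positive_op_def selfadj_bounded_ops complex_nonneg_Reals_iff selfadj_Im)
qed

lemma selfadj_add: "selfadj S \<Longrightarrow> selfadj T \<Longrightarrow> selfadj (S + T)"
  by (simp add: selfadj_def bounded_ops_add blinfun.add_left cinner_add_left cinner_add_right)

lemma selfadj_scaleR: "selfadj T \<Longrightarrow> selfadj (s *\<^sub>R T)"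
  by (auto simp: selfadj_def bounded_ops_scaleR blinfun.scaleR_left cinner_scaleR_right
      Re_cinner_commute[of "s *\<^sub>R _"]) (metis Re_cinner_commute)

lemma selfadj_id: "selfadj id_blinfun"
  by (simp add: selfadj_def bounded_ops_id)

lemma selfadj_zero: "selfadj 0"
  using selfadj_scaleR[OF selfadj_id, of 0] by simp

lemma selfadj_compose:
  assumes "selfadj S" "selfadj T" "S o\<^sub>L T = T o\<^sub>L S"
  shows "selfadj (S o\<^sub>L T)"
proof -
  have "Re (cinner x ((S o\<^sub>L T) y)) = Re (cinner ((T o\<^sub>L S) x) y)" for x y
    by (simp add: selfadjD[OF assms(1)] selfadjD[OF assms(2)])
  then show ?thesis
    using assms by (simp add: selfadj_def bounded_ops_compose)
qed

lemma selfadj_conjugate: "selfadj P \<Longrightarrow> selfadj T \<Longrightarrow> selfadj (P o\<^sub>L T o\<^sub>L P)"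
  unfolding selfadj_def by (auto intro: bounded_ops_compose)

text \<open>Both conditions are pointwise identities that survive norm limits. This carries
  self-adjointness from polynomials of an operator to its functional calculus.\<close>

lemma selfadj_lim:
  assumes "f \<longlonglongrightarrow> S" "\<And>k. selfadj (f k)"
  shows "selfadj S"
proof -
  have lim: "(\<lambda>k. f k x) \<longlonglongrightarrow> S x" for x
    by (intro tendsto_intros assms)
  have "S (c *\<^sub>C x) = c *\<^sub>C S x" for c x
  proof -
    have "(\<lambda>k. scalar_op c (f k x)) \<longlonglongrightarrow> scalar_op c (S x)"
      by (intro tendsto_intros lim)
    then have "(\<lambda>k. f k (c *\<^sub>C x)) \<longlonglongrightarrow> c *\<^sub>C S x"
      by (simp add: scalar_op.rep_eq bounded_opsD[OF selfadj_bounded_ops[OF assms(2)]])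
    then show ?thesis
      by (rule LIMSEQ_unique[OF lim])
  qed
  moreover have "Re (cinner x (S y)) = Re (cinner (S x) y)" for x y
  proof (rule LIMSEQ_unique)
    show "(\<lambda>k. Re (cinner x (f k y))) \<longlonglongrightarrow> Re (cinner x (S y))"
      by (intro tendsto_Re_cinner tendsto_const lim)
    have "(\<lambda>k. Re (cinner (f k x) y)) \<longlonglongrightarrow> Re (cinner (S x) y)"
      by (intro tendsto_Re_cinner tendsto_const lim)
    then show "(\<lambda>k. Re (cinner x (f k y))) \<longlonglongrightarrow> Re (cinner (S x) y)"
      by (simp add: selfadjD[OF assms(2)])
  qed
  ultimately show ?thesis
    by (simp add: selfadj_def bounded_ops_def)
qed

lemma positive_op_add: "positive_op S \<Longrightarrow> positive_op T \<Longrightarrow> positive_op (S + T)"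
  by (simp add: positive_op_iff selfadj_add blinfun.add_left cinner_add_right)

lemma positive_op_zero: "positive_op 0"
  by (simp add: positive_op_iff selfadj_zero linear_0[OF linear_cinner])

lemma positive_op_sum: "(\<And>i. i \<in> I \<Longrightarrow> positive_op (f i)) \<Longrightarrow> positive_op (sum f I)"
  by (induction I rule: infinite_finite_induct) (auto intro: positive_op_add positive_op_zero)

lemma positive_op_conjugate:
  assumes "selfadj P" "positive_op T"
  shows "positive_op (P o\<^sub>L T o\<^sub>L P)"
proof -
  have "Re (cinner x ((P o\<^sub>L T o\<^sub>L P) x)) = Re (cinner (P x) (T (P x)))" for x
    by (simp add: selfadjD[OF assms(1)])
  with assms show ?thesis
    by (simp add: positive_op_iff selfadj_conjugate)
qed

subsection \<open>Coercive operators and the spectrum\<close>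

text \<open>The inverse is the sum of the powers of \<open>K\<close>, which converges by comparison
  with a geometric series. Composing with \<open>K\<close> on either side only drops the term
  \<open>id_blinfun\<close>.\<close>

lemma neumann_inverse:
  fixes K :: "'a::banach \<Rightarrow>\<^sub>L 'a"
  assumes "norm K < 1"
  obtains S where "S o\<^sub>L (id_blinfun - K) = id_blinfun" "(id_blinfun - K) o\<^sub>L S = id_blinfun"
proof
  define F where "F n = (((o\<^sub>L) K) ^^ n) id_blinfun" for n
  have F0: "F 0 = id_blinfun" and FS: "F (Suc n) = K o\<^sub>L F n" for n
    by (simp_all add: F_def)
  \<comment> \<open>Powers of \<open>K\<close> commute with \<open>K\<close>; this form of the
    recursion yields the left inverse, \<open>FS\<close> the right one.\<close>
  have FS': "F (Suc n) = F n o\<^sub>L K" for n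
  proof (induction n)
    case 0
    then show ?case by (simp add: FS F0 blinfun_compose_id)
  next
    case (Suc n)
    then show ?case by (metis FS blinfun_compose_assoc)
  qed
  have "norm (F n) \<le> norm K ^ n" for n
  proof (induction n)
    case 0
    then show ?case by (simp add: F0 norm_blinfun_id_le)
  next
    case (Suc n)
    have "norm (F (Suc n)) \<le> norm K * norm (F n)"
      by (simp add: FS norm_blinfun_compose)
    also have "\<dots> \<le> norm K * norm K ^ n"
      using Suc by (simp add: mult_left_mono)
    finally show ?case by simp
  qed
  then have sum: "summable F"
    using assms by (intro summable_comparison_test[of F "\<lambda>n. norm K ^ n"] summable_geometric) auto
  define S where "S = suminf F"
  have shift: "(\<Sum>n. F (Suc n)) = S - id_blinfun"
    using suminf_split_head[OF sum] by (simp add: F0 S_def)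
  have "K o\<^sub>L S = S - id_blinfun"
    using bounded_linear.suminf[OF blinfun_compose.bounded_linear_right sum, of K]
    by (simp add: S_def[symmetric] shift flip: FS)
  then show "(id_blinfun - K) o\<^sub>L S = id_blinfun"
    by (simp add: blinfun_compose.diff_left blinfun_compose_id)
  have "S o\<^sub>L K = S - id_blinfun"
    using bounded_linear.suminf[OF blinfun_compose.bounded_linear_left sum, of K]
    by (simp add: S_def[symmetric] shift flip: FS')
  then show "S o\<^sub>L (id_blinfun - K) = id_blinfun"
    by (simp add: blinfun_compose.diff_right blinfun_compose_id)
qed

text \<open>Lax--Milgram: for small \<open>s > 0\<close> the operator \<open>id - s T\<close> is a contraction.\<close>

lemma invertible_op_coercive:
  assumes T: "T \<in> bounded_ops" and m: "0 < m"
    and coercive: "\<And>x. m * (norm x)\<^sup>2 \<le> Re (cinner x (T x))"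
  shows "invertible_op T"
proof -
  define M where "M = norm T + 1"
  have M: "0 < M" by (simp add: M_def add_nonneg_pos)
  \<comment> \<open>This \<open>s\<close> minimizes
    \<open>1 - 2 * s * m + s\<^sup>2 * M\<^sup>2\<close>, with minimum
    \<open>1 - (m / M)\<^sup>2\<close>. The \<open>max 0\<close> in \<open>k\<close> covers the zero
    space, where \<open>m\<close> may exceed \<open>M\<close>.\<close>
  define s where "s = m / M\<^sup>2"
  have s: "0 < s" using m M by (simp add: s_def)
  define k where "k = sqrt (max 0 (1 - (m / M)\<^sup>2))"
  have "0 < (m / M)\<^sup>2" using m M by simp
  then have k: "0 \<le> k" "k < 1" unfolding k_def by (auto simp: max_def)
  let ?K = "id_blinfun - s *\<^sub>R T"
  have "norm (?K x) \<le> k * norm x" for x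
  proof -
    have "norm (T x) \<le> M * norm x"
      using norm_blinfun[of T x] norm_ge_zero[of x] unfolding M_def distrib_right by linarith
    then have Tx: "(norm (T x))\<^sup>2 \<le> M\<^sup>2 * (norm x)\<^sup>2"
      by (metis norm_ge_zero power_mono power_mult_distrib)
    have "(norm (?K x))\<^sup>2 = (norm (x + (- s) *\<^sub>R T x))\<^sup>2"
      by (simp add: blinfun.diff_left blinfun.scaleR_left)
    also have "\<dots> = (norm x)\<^sup>2 - 2 * s * Re (cinner x (T x)) + s\<^sup>2 * (norm (T x))\<^sup>2"
      by (simp only: norm_add_power2 cinner_scaleR_right) (simp add: power_mult_distrib)
    also have "\<dots> \<le> (norm x)\<^sup>2 - 2 * s * (m * (norm x)\<^sup>2) + s\<^sup>2 * (M\<^sup>2 * (norm x)\<^sup>2)"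
      using s coercive[of x] Tx by (intro add_mono diff_mono mult_left_mono) auto
    also have "\<dots> = (1 - (m / M)\<^sup>2) * (norm x)\<^sup>2"
      using M by (simp add: s_def field_simps power2_eq_square)
    also have "\<dots> \<le> (k * norm x)\<^sup>2"
      by (simp add: k_def power_mult_distrib mult_right_mono)
    finally show ?thesis
      using k by (simp add: power2_le_iff_abs_le)
  qed
  then have "norm ?K \<le> k"
    using k by (intro norm_blinfun_bound) auto
  then obtain S where "S o\<^sub>L (id_blinfun - ?K) = id_blinfun" "(id_blinfun - ?K) o\<^sub>L S = id_blinfun"
    using k neumann_inverse[of ?K] by auto
  then have "(s *\<^sub>R S) o\<^sub>L T = id_blinfun" "T o\<^sub>L (s *\<^sub>R S) = id_blinfun"
    by (simp_all add: blinfun_compose.scaleR_left blinfun_compose.scaleR_right)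
  with T show ?thesis by (rule invertible_opI)
qed

text \<open>A nonzero scalar factor does not affect invertibility, so the form may first be rotated.
  The factors used later are \<open>\<i>\<close> and \<open>- \<i>\<close> off the real line and
  \<open>- 1\<close> above the norm.\<close>

lemma invertible_op_coercive_multiple:
  assumes T: "T \<in> bounded_ops" and m: "0 < m" and w: "w \<noteq> 0"
    and coercive: "\<And>x. m * (norm x)\<^sup>2 \<le> Re (w * cinner x (T x))"
  shows "invertible_op T"
proof -
  have "invertible_op (scalar_op w o\<^sub>L T)"
    using assms by (intro invertible_op_coercive[of _ m])
      (auto simp: bounded_ops_compose bounded_ops_scalar_op scalar_op.rep_eq cinner_scaleC_right)
  then have "invertible_op (scalar_op (inverse w) o\<^sub>L (scalar_op w o\<^sub>L T))"
    using w by (simp add: invertible_op_compose invertible_scalar_op)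
  moreover have "scalar_op (inverse w) o\<^sub>L (scalar_op w o\<^sub>L T) = T"
    using w by (intro blinfun_eqI) (simp add: scalar_op.rep_eq scaleC_scaleC scaleC_one)
  ultimately show ?thesis by simp
qed

text \<open>Positivity gives \<open>(norm (T x))\<^sup>2 \<le> M * Re (cinner x (T x))\<close>, and
  a bounded inverse gives \<open>norm x \<le> L * norm (T x)\<close>; together they bound the form
  below.\<close>

lemma positive_invertible_coercive:
  assumes "positive_op T" "invertible_op T"
  obtains m where "0 < m" "\<And>x. m * (norm x)\<^sup>2 \<le> Re (cinner x (T x))"
proof -
  have sa: "selfadj T" and pos: "\<And>x. 0 \<le> Re (cinner x (T x))"
    using assms by (auto simp: positive_op_iff)
  obtain S where "S o\<^sub>L T = id_blinfun"
    using assms(2) unfolding invertible_op_def by blast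
  then have ST: "S (T x) = x" for x
    by (metis blinfun_apply_blinfun_compose blinfun_apply_id_blinfun id_apply)
  define M where "M = norm T + 1"
  define L where "L = norm S + 1"
  have M: "0 < M" and L: "0 < L" by (simp_all add: M_def L_def add_nonneg_pos)
  have "(norm (T x))\<^sup>2 / M \<le> Re (cinner x (T x))" for x
  proof -
    \<comment> \<open>Positivity is tested at \<open>x - s T x\<close>. With
      \<open>s = 1 / M\<close> the quadratic term is at most
      \<open>s * (norm (T x))\<^sup>2\<close>, half of what the linear terms subtract.\<close>
    define s where "s = 1 / M"
    let ?y = "x + (- s) *\<^sub>R T x"
    have "0 \<le> Re (cinner ?y (T ?y))" by (rule pos)
    also have "\<dots> = Re (cinner x (T x)) - s * Re (cinner x (T (T x))) - s * Re (cinner (T x) (T x))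
        + s\<^sup>2 * Re (cinner (T x) (T (T x)))"
    proof -
      have "Re (cinner ((- s) *\<^sub>R u) v) = - s * Re (cinner u v)" for u v :: 'a
        by (subst (1 2) Re_cinner_commute) (simp add: cinner_scaleR_right cinner_minus_right)
      then show ?thesis
        by (simp add: blinfun.add_right blinfun.scaleR_right blinfun.minus_right blinfun.diff_right
            cinner_diff_right cinner_scaleR_right cinner_add_left cinner_add_right power2_eq_square
            algebra_simps del: scaleR_minus_left)
    qed
    also have "\<dots> = Re (cinner x (T x)) - 2 * s * (norm (T x))\<^sup>2 + s\<^sup>2 * Re (cinner (T x) (T (T x)))"
      by (simp add: selfadjD[OF sa, of x] Re_cinner_self)
    also have "Re (cinner (T x) (T (T x))) \<le> M * (norm (T x))\<^sup>2"
    proof -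
      have "Re (cinner (T x) (T (T x))) \<le> norm (T x) * (norm T * norm (T x))"
        by (rule order_trans[OF Re_cinner_le]) (simp add: mult_left_mono norm_blinfun)
      then show ?thesis
        by (simp add: M_def power2_eq_square algebra_simps add_increasing)
    qed
    finally show ?thesis
      using M by (simp add: s_def power2_eq_square field_simps)
  qed
  note * = this
  have "1 / (L\<^sup>2 * M) * (norm x)\<^sup>2 \<le> Re (cinner x (T x))" for x
  proof -
    have "norm x \<le> L * norm (T x)"
      using norm_blinfun[of S "T x"] norm_ge_zero[of "T x"] unfolding ST L_def distrib_right by linarith
    then have "(norm x)\<^sup>2 \<le> L\<^sup>2 * (norm (T x))\<^sup>2"
      by (metis norm_ge_zero power_mono power_mult_distrib)
    then have "1 / (L\<^sup>2 * M) * (norm x)\<^sup>2 \<le> (norm (T x))\<^sup>2 / M"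
      using L M by (simp add: field_simps)
    also have "\<dots> \<le> Re (cinner x (T x))" by (rule *)
    finally show ?thesis .
  qed
  moreover have "0 < 1 / (L\<^sup>2 * M)" using L M by simp
  ultimately show ?thesis using that by blast
qed

section \<open>Location of the spectrum\<close>

lemma cinner_diff_scalar_op:
  "cinner x ((T - scalar_op z) x) = cinner x (T x) - z * complex_of_real ((norm x)\<^sup>2)"
  by (simp add: blinfun.diff_left cinner_diff_right scalar_op.rep_eq cinner_scaleC_right cinner_self)

lemma spectrum_selfadj_real:
  assumes "selfadj T" "z \<in> op_spectrum T"
  shows "Im z = 0"
proof (rule ccontr)
  assume z: "Im z \<noteq> 0"
  have "invertible_op (T - scalar_op z)"
  \<comment> \<open>The form of \<open>T\<close> is real, so that of \<open>T - z\<close> has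
    imaginary part \<open>- Im z * (norm x)\<^sup>2\<close>; the factor \<open>w\<close> turns it
    into a positive real part.\<close>
  proof (rule invertible_op_coercive_multiple[where m = "\<bar>Im z\<bar>" and w = "of_real (sgn (Im z)) * \<i>"])
    show "\<bar>Im z\<bar> * (norm x)\<^sup>2 \<le> Re (of_real (sgn (Im z)) * \<i> * cinner x ((T - scalar_op z) x))" for x
      using selfadj_Im[OF assms(1), of x]
      by (simp add: cinner_diff_scalar_op abs_sgn[of "Im z"] algebra_simps del: of_real_power)
  qed (use z assms in \<open>auto simp: selfadj_bounded_ops bounded_ops_diff bounded_ops_scalar_op sgn_0_0\<close>)
  with assms(2) show False by (simp add: op_spectrum_def)
qed

lemma spectrum_lower:
  assumes "T \<in> bounded_ops" "complex_of_real z \<in> op_spectrum T"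
    and "\<And>x. m * (norm x)\<^sup>2 \<le> Re (cinner x (T x))"
  shows "m \<le> z"
proof (rule ccontr)
  assume "\<not> m \<le> z"
  then have "invertible_op (T - scalar_op (of_real z))"
    using assms by (intro invertible_op_coercive[where m = "m - z"])
      (auto simp: cinner_diff_scalar_op bounded_ops_diff bounded_ops_scalar_op algebra_simps simp del: of_real_power)
  with assms(2) show False by (simp add: op_spectrum_def)
qed

text \<open>By Cauchy-Schwarz the form of \<open>T\<close> is at most
  \<open>norm T * (norm x)\<^sup>2\<close>, so the negative of \<open>T - z\<close> is coercive for
  real \<open>z\<close> above \<open>norm T\<close>.\<close>

lemma spectrum_upper:
  assumes "T \<in> bounded_ops" "complex_of_real z \<in> op_spectrum T"
  shows "z \<le> norm T"
proof (rule ccontr)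
  assume z: "\<not> z \<le> norm T"
  have "Re (cinner x (T x)) \<le> norm T * (norm x)\<^sup>2" for x
  proof -
    have "Re (cinner x (T x)) \<le> norm x * (norm T * norm x)"
      by (rule order_trans[OF Re_cinner_le]) (simp add: mult_left_mono norm_blinfun)
    then show ?thesis by (simp add: power2_eq_square mult_ac)
  qed
  then have "invertible_op (T - scalar_op (of_real z))"
    using assms z by (intro invertible_op_coercive_multiple[where m = "z - norm T" and w = "- 1"])
      (auto simp: cinner_diff_scalar_op bounded_ops_diff bounded_ops_scalar_op algebra_simps simp del: of_real_power)
  with assms(2) show False by (simp add: op_spectrum_def)
qed

subsection \<open>Polynomials of a self-adjoint operator\<close>

text \<open>Splitting into linear factors requires complex coefficients. They act through
  \<open>scalar_op\<close>, because the type of operators is a vector space over the reals.\<close>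

definition cop_poly :: "complex poly \<Rightarrow> ('a::chilbert_space \<Rightarrow>\<^sub>L 'a) \<Rightarrow> ('a \<Rightarrow>\<^sub>L 'a)"
  where "cop_poly q T = (\<Sum>i\<le>degree q. scalar_op (coeff q i) o\<^sub>L (((o\<^sub>L) T ^^ i) id_blinfun))"

lemma scalar_op_of_real: "scalar_op (complex_of_real s) o\<^sub>L T = s *\<^sub>R T"
  by (rule blinfun_eqI) (simp add: scalar_op.rep_eq scaleC_of_real blinfun.scaleR_left)

lemma scalar_op_commute: "T \<in> bounded_ops \<Longrightarrow> T o\<^sub>L scalar_op z = scalar_op z o\<^sub>L T"
  by (rule blinfun_eqI) (simp add: scalar_op.rep_eq bounded_opsD)

lemma scalar_op_zero: "scalar_op 0 = 0"
  using scalar_op_of_real[of 0 id_blinfun] by (simp add: blinfun_compose_id)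

lemma scalar_op_add: "scalar_op (z + w) = scalar_op z + scalar_op w"
  by (rule blinfun_eqI) (simp add: scalar_op.rep_eq blinfun.add_left scaleC_add_left)

lemma scalar_op_mult: "scalar_op (z * w) = scalar_op z o\<^sub>L scalar_op w"
  by (rule blinfun_eqI) (simp add: scalar_op.rep_eq scaleC_scaleC)

lemma cop_poly_of_real: "cop_poly (map_poly complex_of_real p) T = op_poly p T"
  by (simp add: cop_poly_def op_poly_def degree_map_poly coeff_map_poly scalar_op_of_real)

lemma cop_poly_0: "cop_poly 0 T = 0"
  by (simp add: cop_poly_def scalar_op_zero)

text \<open>Horner's recursion; the induction for \<open>cop_poly_synthetic_div\<close> rests on it.
  Complex linearity lets \<open>T\<close> move past the coefficients.\<close>

lemma cop_poly_pCons:
  assumes T: "T \<in> bounded_ops"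
  shows "cop_poly (pCons a q) T = scalar_op a + (T o\<^sub>L cop_poly q T)"
proof (cases "q = 0")
  case True
  then show ?thesis by (simp add: cop_poly_0) (simp add: cop_poly_def blinfun_compose_id)
next
  case False
  have "T o\<^sub>L (scalar_op c o\<^sub>L S) = scalar_op c o\<^sub>L (T o\<^sub>L S)" for c S
    by (simp add: scalar_op_commute[OF T] flip: blinfun_compose_assoc)
  note commute = this
  from False show ?thesis
    unfolding cop_poly_def
    by (simp add: sum.atMost_Suc_shift blinfun_compose.sum_right blinfun_compose_id commute del: sum.atMost_Suc)
qed

lemma op_poly_0: "op_poly 0 T = 0"
  by (simp add: op_poly_def)

lemma op_poly_pCons: "op_poly (pCons a p) T = a *\<^sub>R id_blinfun + (T o\<^sub>L op_poly p T)"
proof (cases "p = 0")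
  case True
  then show ?thesis by (simp add: op_poly_def)
next
  case False
  then show ?thesis
    unfolding op_poly_def
    by (simp add: sum.atMost_Suc_shift blinfun_compose.sum_right blinfun_compose.scaleR_right del: sum.atMost_Suc)
qed

lemma op_poly_smult: "op_poly (smult c p) T = c *\<^sub>R op_poly p T"
  by (induction p) (simp_all add: op_poly_0 op_poly_pCons scaleR_add_right blinfun_compose.scaleR_right)

lemma op_poly_add: "op_poly (p + q) T = op_poly p T + op_poly q T"
  by (induction p q rule: poly_induct2)
    (simp_all add: op_poly_0 op_poly_pCons scaleR_add_left blinfun_compose.add_right algebra_simps)

lemma op_poly_diff: "op_poly (p - q) T = op_poly p T - op_poly q T"
  by (metis add_diff_cancel_right' diff_add_cancel op_poly_add)

lemma op_poly_mult: "op_poly (p * q) T = op_poly p T o\<^sub>L op_poly q T"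
  by (induction p)
    (simp_all add: op_poly_0 op_poly_pCons op_poly_add op_poly_smult blinfun_compose.add_left
      blinfun_compose.scaleR_left blinfun_compose_id blinfun_compose_assoc)

lemma op_poly_const: "op_poly [:c:] T = c *\<^sub>R id_blinfun"
  by (simp add: op_poly_pCons op_poly_0)

text \<open>\<open>T\<close> is the value of the polynomial \<open>[:0, 1:]\<close> at
  \<open>T\<close>, so this is commutativity of polynomial multiplication.\<close>

lemma op_poly_commute: "T o\<^sub>L op_poly p T = op_poly p T o\<^sub>L T"
  using op_poly_mult[of "[:0, 1:]" p T] op_poly_mult[of p "[:0, 1:]" T]
  by (simp add: op_poly_pCons op_poly_0 blinfun_compose_id mult.commute)

lemma selfadj_op_poly: "selfadj T \<Longrightarrow> selfadj (op_poly p T)"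
  by (induction p)
    (auto simp: op_poly_0 op_poly_pCons selfadj_zero op_poly_commute
      intro!: selfadj_add selfadj_scaleR selfadj_id selfadj_compose)

text \<open>Division with remainder by the linear polynomial with root \<open>z\<close>, evaluated
  at \<open>T\<close>. If \<open>z\<close> is a root of \<open>q\<close>, only the product with
  \<open>T - scalar_op z\<close> remains.\<close>

lemma cop_poly_synthetic_div:
  assumes T: "T \<in> bounded_ops"
  shows "cop_poly q T = scalar_op (poly q z) + ((T - scalar_op z) o\<^sub>L cop_poly (synthetic_div q z) T)"
proof (induction q)
  case 0
  then show ?case by (simp add: cop_poly_0 scalar_op_zero)
next
  case (pCons a q)
  let ?S = "cop_poly (synthetic_div q z) T"
  have "T o\<^sub>L ((T - scalar_op z) o\<^sub>L ?S) = (T - scalar_op z) o\<^sub>L (T o\<^sub>L ?S)"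
    by (simp add: blinfun_compose.diff_left blinfun_compose.diff_right scalar_op_commute[OF T]
        flip: blinfun_compose_assoc)
  then show ?case
    by (simp add: cop_poly_pCons[OF T] pCons.IH scalar_op_add scalar_op_mult
        blinfun_compose.diff_left blinfun_compose.diff_right
        blinfun_compose.add_left blinfun_compose.add_right scalar_op_commute[OF T])
qed

text \<open>Induction on the degree: a complex root \<open>z\<close> splits off the factor
  \<open>T - scalar_op z\<close>, invertible since \<open>z\<close> lies outside the spectrum, and
  the roots of the quotient are again roots of \<open>q\<close>.\<close>

lemma invertible_cop_poly:
  assumes T: "T \<in> bounded_ops"
  shows "q \<noteq> 0 \<Longrightarrow> (\<And>z. poly q z = 0 \<Longrightarrow> z \<notin> op_spectrum T) \<Longrightarrow> invertible_op (cop_poly q T)"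
proof (induction "degree q" arbitrary: q)
  case 0
  then obtain c where q: "q = [:c:]" and "c \<noteq> 0"
    by (metis degree_eq_zeroE pCons_0_0)
  then show ?case
    by (simp add: cop_poly_pCons[OF T] cop_poly_0 invertible_scalar_op)
next
  case (Suc d)
  then have "\<not> constant (poly q)"
    by (simp add: constant_degree)
  then obtain z where z: "poly q z = 0"
    using fundamental_theorem_of_algebra by blast
  let ?q = "synthetic_div q z"
  have q: "q = [:- z, 1:] * ?q"
    using synthetic_div_correct'[of z q] z by simp
  have "invertible_op (cop_poly ?q T)"
  proof (rule Suc.hyps(1))
    show "d = degree ?q" using Suc.hyps(2) by (simp add: degree_synthetic_div)
    show "?q \<noteq> 0" using Suc.hyps(2) by (simp add: synthetic_div_eq_0_iff)
    show "y \<notin> op_spectrum T" if "poly ?q y = 0" for y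
      using that Suc.prems(2)[of y] arg_cong[OF q, of "\<lambda>q. poly q y"] by simp
  qed
  moreover have "invertible_op (T - scalar_op z)"
    using Suc.prems(2)[OF z] by (simp add: op_spectrum_def)
  ultimately show ?case
    by (simp add: cop_poly_synthetic_div[OF T, of q z] z scalar_op_zero invertible_op_compose)
qed

section \<open>The norm of a real polynomial of a self-adjoint operator\<close>

abbreviation rspectrum :: "('a::chilbert_space \<Rightarrow>\<^sub>L 'a) \<Rightarrow> real set"
  where "rspectrum T \<equiv> {x. complex_of_real x \<in> op_spectrum T}"

lemma poly_map_poly_of_real:
  "poly (map_poly complex_of_real p) (complex_of_real x) = complex_of_real (poly p x)"
  by (induction p) (simp_all add: map_poly_pCons)

text \<open>The spectrum is real, so non-real zeros of \<open>p\<close> lie outside it and only the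
  values of \<open>p\<close> at real points matter.\<close>

lemma invertible_op_poly:
  assumes T: "selfadj T" and "p \<noteq> 0" and nz: "\<And>x. x \<in> rspectrum T \<Longrightarrow> poly p x \<noteq> 0"
  shows "invertible_op (op_poly p T)"
proof -
  have "invertible_op (cop_poly (map_poly complex_of_real p) T)"
  proof (rule invertible_cop_poly[OF selfadj_bounded_ops[OF T]])
    show "map_poly complex_of_real p \<noteq> 0"
      using \<open>p \<noteq> 0\<close> by (simp add: map_poly_eq_0_iff)
    show "z \<notin> op_spectrum T" if root: "poly (map_poly complex_of_real p) z = 0" for z
    proof
      assume z: "z \<in> op_spectrum T"
      then have "z = complex_of_real (Re z)"
        using spectrum_selfadj_real[OF T z] by (simp add: complex_eq_iff)
      with z root nz[of "Re z"] show False
        by (metis mem_Collect_eq of_real_0 of_real_eq_iff poly_map_poly_of_real)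
    qed
  qed
  then show ?thesis by (simp add: cop_poly_of_real)
qed

text \<open>
  With \<open>N\<close> the norm of \<open>S = p(T)\<close>, the positive operator \<open>N\<^sup>2 - S\<^sup>2\<close> is never bounded
  below, hence not invertible, so that \<open>N\<^sup>2 - p\<^sup>2\<close> has a zero on the spectrum.
\<close>

lemma norm_op_poly_le_aux:
  assumes T: "selfadj T" and e: "0 \<le> e" and pe: "\<And>x. x \<in> rspectrum T \<Longrightarrow> \<bar>poly p x\<bar> \<le> e"
    and nz: "[:(norm (op_poly p T))\<^sup>2:] - p * p \<noteq> 0"
  shows "norm (op_poly p T) \<le> e"
proof (rule ccontr)
  define S where "S = op_poly p T"
  define N where "N = norm S"
  let ?q = "[:N\<^sup>2:] - p * p"
  assume "\<not> norm (op_poly p T) \<le> e"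
  then have N: "e < N" by (simp add: N_def S_def)
  have S: "selfadj S" unfolding S_def by (rule selfadj_op_poly[OF T])
  have qT: "op_poly ?q T = N\<^sup>2 *\<^sub>R id_blinfun - (S o\<^sub>L S)"
    by (simp add: op_poly_diff op_poly_mult op_poly_const S_def)
  have form: "Re (cinner x (op_poly ?q T x)) = N\<^sup>2 * (norm x)\<^sup>2 - (norm (S x))\<^sup>2" for x
    by (simp add: qT blinfun.diff_left blinfun.scaleR_left cinner_diff_right cinner_scaleR_right
        selfadjD[OF S] Re_cinner_self)
  have "(norm (S x))\<^sup>2 \<le> N\<^sup>2 * (norm x)\<^sup>2" for x
    using power_mono[OF norm_blinfun[of S x], of 2] by (simp add: N_def power_mult_distrib)
  then have pos: "positive_op (op_poly ?q T)"
    by (simp add: positive_op_iff selfadj_op_poly[OF T] form)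
  have inv: "invertible_op (op_poly ?q T)"
  proof (rule invertible_op_poly[OF T])
    show "?q \<noteq> 0" using nz by (simp add: N_def S_def)
    fix x assume "x \<in> rspectrum T"
    then have "\<bar>poly p x\<bar> < N" using pe N by fastforce
    then have "(poly p x)\<^sup>2 < N\<^sup>2" by (metis abs_ge_zero power2_abs power_strict_mono zero_less_numeral)
    then show "poly ?q x \<noteq> 0" by (simp add: power2_eq_square)
  qed
  \<comment> \<open>Coercivity of \<open>N\<^sup>2 - S\<^sup>2\<close> improves the bound on
    \<open>S\<close> from \<open>N\<^sup>2\<close> to \<open>N\<^sup>2 - m\<close>, contradicting
    that \<open>N\<close> is the norm of \<open>S\<close>.\<close>
  obtain m where m: "0 < m" and "\<And>x. m * (norm x)\<^sup>2 \<le> N\<^sup>2 * (norm x)\<^sup>2 - (norm (S x))\<^sup>2"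
    using positive_invertible_coercive[OF pos inv] unfolding form by blast
  then have le: "(norm (S x))\<^sup>2 \<le> (N\<^sup>2 - m) * (norm x)\<^sup>2" for x
    by (simp add: algebra_simps)
  define k where "k = sqrt (max 0 (N\<^sup>2 - m))"
  have k: "0 \<le> k" by (simp add: k_def)
  have "norm (S x) \<le> k * norm x" for x
  proof -
    have "(norm (S x))\<^sup>2 \<le> (k * norm x)\<^sup>2"
      by (rule order_trans[OF le]) (simp add: k_def power_mult_distrib mult_right_mono)
    then show ?thesis using k by (simp add: power2_le_iff_abs_le)
  qed
  then have "N \<le> k"
    unfolding N_def using k by (intro norm_blinfun_bound) auto
  then have "N\<^sup>2 \<le> k\<^sup>2" using N e by (intro power_mono) auto
  also have "\<dots> = max 0 (N\<^sup>2 - m)" by (simp add: k_def)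
  finally show False using m N e by (auto simp: max_def split: if_splits)
qed

text \<open>Two degenerate cases remain. An empty spectrum forces the zero space. If the polynomial
  \<open>N\<^sup>2 - p\<^sup>2\<close> is zero, with \<open>N\<close> the norm of
  \<open>op_poly p T\<close>, then \<open>p\<close> has absolute value \<open>N\<close> at any point
  of the spectrum.\<close>

lemma norm_op_poly_le:
  assumes T: "selfadj T" and e: "0 \<le> e" and pe: "\<And>x. x \<in> rspectrum T \<Longrightarrow> \<bar>poly p x\<bar> \<le> e"
  shows "norm (op_poly p T) \<le> e"
proof (cases "rspectrum T = {}")
  case True
  \<comment> \<open>Over an empty spectrum the bound \<open>0\<close> holds vacuously, here for the
    polynomial whose value at \<open>T\<close> is \<open>T\<close>. So \<open>T = 0\<close>, yet
    \<open>0\<close> is not in the spectrum, and the zero operator is invertible.\<close>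
  have "norm (op_poly [:0, 1:] T) \<le> 0"
    by (rule norm_op_poly_le_aux[OF T]) (use True in auto)
  then have "T = 0" by (simp add: op_poly_pCons op_poly_0 blinfun_compose_id)
  moreover have "0 \<notin> rspectrum T" using True by blast
  ultimately have "invertible_op (0 :: 'a \<Rightarrow>\<^sub>L 'a)"
    by (simp add: op_spectrum_def scalar_op_zero)
  then have id0: "(id_blinfun :: 'a \<Rightarrow>\<^sub>L 'a) = 0"
    by (auto simp: invertible_op_def)
  have "op_poly p T = op_poly p T o\<^sub>L id_blinfun" by (simp add: blinfun_compose_id)
  also have "\<dots> = 0" by (simp add: id0)
  finally show ?thesis using e by simp
next
  case False
  then obtain x where x: "x \<in> rspectrum T" by blast
  show ?thesis
  proof (cases "[:(norm (op_poly p T))\<^sup>2:] - p * p = 0")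
    case True
    then have "poly ([:(norm (op_poly p T))\<^sup>2:] - p * p) x = 0" by simp
    then have "(norm (op_poly p T))\<^sup>2 = \<bar>poly p x\<bar>\<^sup>2" by (simp add: power2_eq_square)
    then have "norm (op_poly p T) = \<bar>poly p x\<bar>" by (metis abs_ge_zero norm_ge_zero power2_eq_iff_nonneg)
    with pe[OF x] show ?thesis by simp
  next
    case False
    with assms show ?thesis by (rule norm_op_poly_le_aux)
  qed
qed

subsection \<open>Continuous functional calculus\<close>

lemma Weierstrass_poly_uniform_limit:
  assumes "continuous_on {a..b} f"
  obtains p :: "nat \<Rightarrow> real poly"
  where "uniform_limit {a..b} (\<lambda>k x. poly (p k) x) f sequentially"
proof -
  have "\<exists>p. \<forall>x\<in>{a..b}. \<bar>f x - poly p x\<bar> < inverse (real (Suc n))" for n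
  proof -
    obtain g where g: "real_polynomial_function g" "\<And>x. x \<in> {a..b} \<Longrightarrow> \<bar>f x - g x\<bar> < inverse (real (Suc n))"
      using Stone_Weierstrass_real_polynomial_function[OF _ assms, of "inverse (real (Suc n))"] by auto
    then obtain c d where "g = (\<lambda>x. \<Sum>i\<le>d. c i * x ^ i)"
      by (auto simp: real_polynomial_function_iff_sum)
    then have "poly (\<Sum>i\<le>d. monom (c i) i) x = g x" for x
      by (simp add: poly_sum poly_monom)
    with g(2) show ?thesis by metis
  qed
  then obtain p where p: "\<And>n x. x \<in> {a..b} \<Longrightarrow> \<bar>f x - poly (p n) x\<bar> < inverse (real (Suc n))"
    by metis
  have "uniform_limit {a..b} (\<lambda>k x. poly (p k) x) f sequentially"
  proof (rule uniform_limitI)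
    fix e :: real assume "0 < e"
    then have "\<forall>\<^sub>F n in sequentially. inverse (real (Suc n)) < e"
      by (rule order_tendstoD(2)[OF LIMSEQ_inverse_real_of_nat])
    then show "\<forall>\<^sub>F n in sequentially. \<forall>x\<in>{a..b}. dist (poly (p n) x) (f x) < e"
      by eventually_elim (auto simp: dist_real_def abs_minus_commute intro: less_trans[OF p])
  qed
  then show ?thesis by (rule that)
qed

text \<open>The norm bound turns uniform closeness of polynomials on the spectrum into norm
  closeness of operators. Hence approximating sequences converge to a common limit, and the
  existence of one such sequence makes the description in \<open>cfc\<close> unique.\<close>

lemma cfc_tendsto:
  assumes T: "selfadj T"
    and p: "uniform_limit (rspectrum T) (\<lambda>k x. poly (p k) x) f sequentially"
  shows "(\<lambda>k. op_poly (p k) T) \<longlonglongrightarrow> cfc f T"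
proof -
  \<comment> \<open>With \<open>q' = q\<close> this is the Cauchy property; with two sequences it
    says that their limits agree.\<close>
  have close: "\<exists>M. \<forall>k\<ge>M. \<forall>l\<ge>M. dist (op_poly (q k) T) (op_poly (q' l) T) < e"
    if q: "uniform_limit (rspectrum T) (\<lambda>k x. poly (q k) x) f sequentially"
      and q': "uniform_limit (rspectrum T) (\<lambda>k x. poly (q' k) x) f sequentially" and e: "0 < e"
    for q q' :: "nat \<Rightarrow> real poly" and e
  proof -
    from e have "0 < e / 4" by simp
    with q q' obtain M M'
      where M: "\<And>k x. M \<le> k \<Longrightarrow> x \<in> rspectrum T \<Longrightarrow> dist (poly (q k) x) (f x) < e / 4"
        and M': "\<And>k x. M' \<le> k \<Longrightarrow> x \<in> rspectrum T \<Longrightarrow> dist (poly (q' k) x) (f x) < e / 4"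
      unfolding uniform_limit_iff eventually_sequentially by metis
    have "dist (op_poly (q k) T) (op_poly (q' l) T) < e" if "max M M' \<le> k" "max M M' \<le> l" for k l
    proof -
      have "norm (op_poly (q k - q' l) T) \<le> e / 2"
      proof (rule norm_op_poly_le[OF T])
        fix x assume x: "x \<in> rspectrum T"
        show "\<bar>poly (q k - q' l) x\<bar> \<le> e / 2"
          using M[OF _ x, of k] M'[OF _ x, of l] that unfolding dist_real_def poly_diff by linarith
      qed (use e in simp)
      with e show ?thesis by (simp add: dist_norm op_poly_diff)
    qed
    then show ?thesis by blast
  qed
  have "Cauchy (\<lambda>k. op_poly (p k) T)"
    unfolding Cauchy_def using close[OF p p] by blast
  then obtain S where S: "(\<lambda>k. op_poly (p k) T) \<longlonglongrightarrow> S"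
    by (auto simp: Cauchy_convergent_iff convergent_def)
  have all: "(\<lambda>k. op_poly (q k) T) \<longlonglongrightarrow> S"
    if "uniform_limit (rspectrum T) (\<lambda>k x. poly (q k) x) f sequentially" for q
  proof -
    have "(\<lambda>k. op_poly (q k) T - op_poly (p k) T) \<longlonglongrightarrow> 0"
      using close[OF that p] by (intro LIMSEQ_I) (fastforce simp: dist_norm)
    then show ?thesis by (rule Lim_transform[OF S])
  qed
  have "cfc f T = S"
    unfolding cfc_def
  proof (rule the_equality)
    show "\<forall>p. uniform_limit (rspectrum T) (\<lambda>k x. poly (p k) x) f sequentially \<longrightarrow> (\<lambda>k. op_poly (p k) T) \<longlonglongrightarrow> S"
      using all by blast
    show "S' = S" if "\<forall>p. uniform_limit (rspectrum T) (\<lambda>k x. poly (p k) x) f sequentially \<longrightarrow> (\<lambda>k. op_poly (p k) T) \<longlonglongrightarrow> S'" for S'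
      using that p S LIMSEQ_unique by blast
  qed
  with S show ?thesis by simp
qed

lemma cfc_eqI:
  assumes "selfadj T" "uniform_limit (rspectrum T) (\<lambda>k x. poly (p k) x) f sequentially"
    and "(\<lambda>k. op_poly (p k) T) \<longlonglongrightarrow> S"
  shows "cfc f T = S"
  using assms by (intro LIMSEQ_unique[OF cfc_tendsto])

lemma cfc_poly: "selfadj T \<Longrightarrow> cfc (poly p) T = op_poly p T"
  by (rule cfc_eqI[of _ "\<lambda>k. p"]) (auto intro: uniform_limit_const)

lemma cfc_cong:
  assumes "\<And>x. x \<in> rspectrum T \<Longrightarrow> f x = g x"
  shows "cfc f T = cfc g T"
proof -
  have "uniform_limit (rspectrum T) (\<lambda>k x. poly (p k) x) f sequentially
    \<longleftrightarrow> uniform_limit (rspectrum T) (\<lambda>k x. poly (p k) x) g sequentially" for p :: "nat \<Rightarrow> real poly"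
    using assms by (rule uniform_limit_cong'[OF refl])
  then show ?thesis unfolding cfc_def by (simp only:)
qed

text \<open>The rules of the calculus work on approximating sequences, so approximability stands in
  for continuity. Boundedness makes the product of two uniform limits uniform and supplies the
  constant \<open>c\<close> in \<open>positive_cfc\<close>.\<close>

definition poly_approximable :: "('a::chilbert_space \<Rightarrow>\<^sub>L 'a) \<Rightarrow> (real \<Rightarrow> real) \<Rightarrow> bool"
  where "poly_approximable T f \<longleftrightarrow> bounded (f ` rspectrum T) \<and>
    (\<exists>p :: nat \<Rightarrow> real poly. uniform_limit (rspectrum T) (\<lambda>k x. poly (p k) x) f sequentially)"

lemma poly_approximableI:
  fixes p :: "nat \<Rightarrow> real poly"
  assumes "bounded (f ` rspectrum T)"
    and "uniform_limit (rspectrum T) (\<lambda>k x. poly (p k) x) f sequentially"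
  shows "poly_approximable T f"
  using assms unfolding poly_approximable_def by blast

lemma cfc_add:
  assumes T: "selfadj T" and "poly_approximable T f" "poly_approximable T g"
  shows "cfc (\<lambda>x. f x + g x) T = cfc f T + cfc g T"
    and "poly_approximable T (\<lambda>x. f x + g x)"
proof -
  obtain p q where p: "uniform_limit (rspectrum T) (\<lambda>k x. poly (p k) x) f sequentially"
    and q: "uniform_limit (rspectrum T) (\<lambda>k x. poly (q k) x) g sequentially"
    using assms unfolding poly_approximable_def by blast
  have lim: "uniform_limit (rspectrum T) (\<lambda>k x. poly (p k + q k) x) (\<lambda>x. f x + g x) sequentially"
    using uniform_limit_add[OF p q] by simp
  show "cfc (\<lambda>x. f x + g x) T = cfc f T + cfc g T"
    by (rule cfc_eqI[OF T lim]) (simp add: op_poly_add tendsto_add cfc_tendsto[OF T p] cfc_tendsto[OF T q])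
  show "poly_approximable T (\<lambda>x. f x + g x)"
    using assms by (intro poly_approximableI[OF _ lim] bounded_plus_comp) (simp_all add: poly_approximable_def)
qed

lemma cfc_mult:
  assumes T: "selfadj T" and "poly_approximable T f" "poly_approximable T g"
  shows "cfc (\<lambda>x. f x * g x) T = cfc f T o\<^sub>L cfc g T"
proof -
  obtain p q where p: "uniform_limit (rspectrum T) (\<lambda>k x. poly (p k) x) f sequentially"
    and q: "uniform_limit (rspectrum T) (\<lambda>k x. poly (q k) x) g sequentially"
    using assms unfolding poly_approximable_def by blast
  have lim: "uniform_limit (rspectrum T) (\<lambda>k x. poly (p k * q k) x) (\<lambda>x. f x * g x) sequentially"
    using uniform_lim_mult[OF p q] assms by (simp add: poly_approximable_def)
  show "cfc (\<lambda>x. f x * g x) T = cfc f T o\<^sub>L cfc g T"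
    by (rule cfc_eqI[OF T lim])
      (simp add: op_poly_mult blinfun_compose.tendsto cfc_tendsto[OF T p] cfc_tendsto[OF T q])
qed

lemma poly_approximable_const: "poly_approximable T (\<lambda>x. c)"
proof (rule poly_approximableI)
  show "bounded ((\<lambda>x. c) ` rspectrum T)"
    by (rule bounded_subset[of "{c}"]) auto
  show "uniform_limit (rspectrum T) (\<lambda>k x. poly [:c:] x) (\<lambda>x. c) sequentially"
    by (simp add: uniform_limit_const)
qed

lemma cfc_const: "selfadj T \<Longrightarrow> cfc (\<lambda>x. c) T = c *\<^sub>R id_blinfun"
  by (rule cfc_eqI[of _ "\<lambda>k. [:c:]"]) (auto simp: op_poly_const intro: uniform_limit_const)

lemma cfc_scaleR:
  assumes T: "selfadj T" and "poly_approximable T f"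
  shows "cfc (\<lambda>x. c * f x) T = c *\<^sub>R cfc f T" and "poly_approximable T (\<lambda>x. c * f x)"
proof -
  obtain p where p: "uniform_limit (rspectrum T) (\<lambda>k x. poly (p k) x) f sequentially"
    using assms unfolding poly_approximable_def by blast
  have lim: "uniform_limit (rspectrum T) (\<lambda>k x. poly (smult c (p k)) x) (\<lambda>x. c * f x) sequentially"
    using bounded_linear.uniform_limit[OF bounded_linear_mult_right p] by simp
  show "cfc (\<lambda>x. c * f x) T = c *\<^sub>R cfc f T"
    by (rule cfc_eqI[OF T lim]) (auto simp: op_poly_smult intro!: tendsto_intros cfc_tendsto[OF T p])
  show "poly_approximable T (\<lambda>x. c * f x)"
    using assms bounded_scaling[of "f ` rspectrum T" c]
    by (intro poly_approximableI[OF _ lim]) (simp add: poly_approximable_def image_image)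
qed

lemma selfadj_cfc:
  assumes T: "selfadj T" and "poly_approximable T f"
  shows "selfadj (cfc f T)"
  using assms cfc_tendsto[OF T] selfadj_op_poly[OF T] unfolding poly_approximable_def
  by (blast intro: selfadj_lim)

lemma norm_cfc_le:
  assumes T: "selfadj T" and f: "poly_approximable T f"
    and e: "0 \<le> e" and fe: "\<And>x. x \<in> rspectrum T \<Longrightarrow> \<bar>f x\<bar> \<le> e"
  shows "norm (cfc f T) \<le> e"
proof (rule field_le_epsilon)
  fix d :: real assume d: "0 < d"
  obtain p where p: "uniform_limit (rspectrum T) (\<lambda>k x. poly (p k) x) f sequentially"
    using f unfolding poly_approximable_def by blast
  have "\<forall>\<^sub>F k in sequentially. norm (op_poly (p k) T) \<le> e + d"
    using uniform_limitD[OF p d]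
  proof eventually_elim
    case (elim k)
    show ?case
    proof (rule norm_op_poly_le[OF T])
      fix x assume "x \<in> rspectrum T"
      with elim fe[of x] show "\<bar>poly (p k) x\<bar> \<le> e + d" by (auto simp: dist_real_def)
    qed (use e d in simp)
  qed
  then show "norm (cfc f T) \<le> e + d"
    by (intro tendsto_upperbound[OF tendsto_norm[OF cfc_tendsto[OF T p]]]) auto
qed

text \<open>If \<open>0 \<le> f x \<le> c\<close> on the spectrum, then \<open>c - f\<close> is
  bounded by \<open>c\<close> there, so \<open>c - f(T)\<close> has norm at most \<open>c\<close>;
  Cauchy-Schwarz then makes the form of \<open>f(T)\<close> nonnegative. No square root of
  \<open>f\<close> is taken.\<close>

lemma positive_cfc:
  assumes T: "selfadj T" and f: "poly_approximable T f"
    and nonneg: "\<And>x. x \<in> rspectrum T \<Longrightarrow> 0 \<le> f x"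
  shows "positive_op (cfc f T)"
proof -
  obtain c where c: "\<And>x. x \<in> rspectrum T \<Longrightarrow> \<bar>f x\<bar> \<le> c" and "0 < c"
    using f unfolding poly_approximable_def bounded_pos by fastforce
  let ?F = "cfc f T"
  have "cfc (\<lambda>x. c + (- 1) * f x) T = cfc (\<lambda>x. c) T + (- 1) *\<^sub>R ?F"
    by (simp only: cfc_add(1)[OF T poly_approximable_const cfc_scaleR(2)[OF T f]] cfc_scaleR(1)[OF T f])
  also have "cfc (\<lambda>x. c) T = c *\<^sub>R id_blinfun"
    by (rule cfc_const[OF T])
  finally have eq: "cfc (\<lambda>x. c + (- 1) * f x) T = c *\<^sub>R id_blinfun - ?F" by simp
  have "norm (cfc (\<lambda>x. c + (- 1) * f x) T) \<le> c"
  proof (rule norm_cfc_le[OF T])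
    show "poly_approximable T (\<lambda>x. c + (- 1) * f x)"
      by (intro cfc_add(2) cfc_scaleR(2) T f poly_approximable_const)
    show "\<bar>c + (- 1) * f x\<bar> \<le> c" if "x \<in> rspectrum T" for x
      using c[OF that] nonneg[OF that] by auto
  qed (use \<open>0 < c\<close> in simp)
  then have le: "norm (c *\<^sub>R id_blinfun - ?F) \<le> c" by (simp only: eq)
  have "0 \<le> Re (cinner x (?F x))" for x
  proof -
    have "Re (cinner x ((c *\<^sub>R id_blinfun - ?F) x)) \<le> norm x * (c * norm x)"
      by (rule order_trans[OF Re_cinner_le])
        (intro mult_left_mono order_trans[OF norm_blinfun] mult_right_mono le norm_ge_zero)
    then show ?thesis
      by (simp add: blinfun.diff_left blinfun.scaleR_left cinner_diff_right cinner_scaleR_right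
          Re_cinner_self power2_eq_square mult_ac)
  qed
  then show ?thesis
    by (simp add: positive_op_iff selfadj_cfc[OF T f])
qed

subsection \<open>Powers and weighted geometric means\<close>

definition pos_inv :: "('a::chilbert_space \<Rightarrow>\<^sub>L 'a) \<Rightarrow> bool"
  where "pos_inv T \<longleftrightarrow> positive_op T \<and> invertible_op T"

lemma pos_inv_selfadj: "pos_inv T \<Longrightarrow> selfadj T"
  by (simp add: pos_inv_def positive_op_iff)

lemma pos_inv_coercive:
  assumes "pos_inv T"
  obtains m where "0 < m" "\<And>x. m * (norm x)\<^sup>2 \<le> Re (cinner x (T x))"
  using that positive_invertible_coercive[of T] assms unfolding pos_inv_def by blast

lemma pos_inv_spectrum:
  assumes "pos_inv T"
  obtains a b where "0 < a" "rspectrum T \<subseteq> {a..b}"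
proof -
  have T: "T \<in> bounded_ops" by (simp add: pos_inv_selfadj[OF assms] selfadj_bounded_ops)
  obtain m where m: "0 < m" "\<And>x. m * (norm x)\<^sup>2 \<le> Re (cinner x (T x))"
    using pos_inv_coercive[OF assms] by blast
  have "rspectrum T \<subseteq> {m..norm T}"
    using spectrum_lower[OF T _ m(2)] spectrum_upper[OF T] by auto
  with m(1) show ?thesis by (rule that)
qed

lemma pos_inv_spectrum_pos: "pos_inv T \<Longrightarrow> x \<in> rspectrum T \<Longrightarrow> 0 < x"
  by (metis atLeastAtMost_iff less_le_trans pos_inv_spectrum subsetD)

text \<open>The spectrum lies in an interval away from \<open>0\<close>, where
  \<open>x powr u\<close> is continuous for negative \<open>u\<close> too.\<close>

lemma poly_approximable_powr:
  assumes "pos_inv T"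
  shows "poly_approximable T (\<lambda>x. x powr u)"
proof -
  obtain a b where ab: "0 < a" "rspectrum T \<subseteq> {a..b}"
    by (rule pos_inv_spectrum[OF assms])
  have cont: "continuous_on {a..b} (\<lambda>x. x powr u)"
    using ab(1) by (intro continuous_intros) auto
  obtain p where "uniform_limit {a..b} (\<lambda>k x. poly (p k) x) (\<lambda>x. x powr u) sequentially"
    using Weierstrass_poly_uniform_limit[OF cont] .
  then have "uniform_limit (rspectrum T) (\<lambda>k x. poly (p k) x) (\<lambda>x. x powr u) sequentially"
    by (rule uniform_limit_on_subset[OF _ ab(2)])
  moreover have "bounded ((\<lambda>x. x powr u) ` rspectrum T)"
    by (rule bounded_subset[OF compact_imp_bounded[OF compact_continuous_image[OF cont]]])
      (use ab(2) in auto)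
  ultimately show ?thesis unfolding poly_approximable_def by blast
qed

lemma selfadj_op_powr: "pos_inv T \<Longrightarrow> selfadj (op_powr T u)"
  unfolding op_powr_def by (intro selfadj_cfc poly_approximable_powr pos_inv_selfadj)

lemma op_powr_add: "pos_inv T \<Longrightarrow> op_powr T (u + v) = op_powr T u o\<^sub>L op_powr T v"
  unfolding op_powr_def powr_add by (intro cfc_mult poly_approximable_powr pos_inv_selfadj)

text \<open>\<open>x powr 0\<close> agrees with the constant \<open>1\<close> away from
  \<open>0\<close>, and the spectrum is positive.\<close>

lemma op_powr_zero:
  assumes "pos_inv T"
  shows "op_powr T 0 = id_blinfun"
proof -
  have "op_powr T 0 = cfc (poly [:1:]) T"
    unfolding op_powr_def by (rule cfc_cong) (use pos_inv_spectrum_pos[OF assms] in fastforce)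
  then show ?thesis
    by (simp only: cfc_poly[OF pos_inv_selfadj[OF assms]] op_poly_const) simp
qed

lemma op_powr_one:
  assumes "pos_inv T"
  shows "op_powr T 1 = T"
proof -
  have "op_powr T 1 = cfc (poly [:0, 1:]) T"
    unfolding op_powr_def by (rule cfc_cong) (use pos_inv_spectrum_pos[OF assms] in fastforce)
  then show ?thesis
    by (simp only: cfc_poly[OF pos_inv_selfadj[OF assms]])
      (simp add: op_poly_pCons op_poly_0 blinfun_compose_id)
qed

lemma op_powr_half:
  assumes "pos_inv T"
  shows "op_powr T (1/2) o\<^sub>L op_powr T (1/2) = T"
    and "op_powr T (1/2) o\<^sub>L op_powr T (-1/2) = id_blinfun"
    and "op_powr T (-1/2) o\<^sub>L op_powr T (1/2) = id_blinfun"
  by (simp_all add: op_powr_zero op_powr_one assms flip: op_powr_add)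

text \<open>One summand is coercive and the others are positive, so the sum is coercive with the
  same constant.\<close>

lemma pos_inv_sum:
  assumes "finite I" "I \<noteq> {}" "\<And>i. i \<in> I \<Longrightarrow> pos_inv (f i)"
  shows "pos_inv (sum f I)"
proof -
  obtain j where j: "j \<in> I" using assms(2) by blast
  obtain m where m: "0 < m" "\<And>x. m * (norm x)\<^sup>2 \<le> Re (cinner x (f j x))"
    using pos_inv_coercive[OF assms(3)[OF j]] by blast
  have pos: "positive_op (sum f I)"
    using assms by (intro positive_op_sum) (auto simp: pos_inv_def)
  have "positive_op (sum f (I - {j}))"
    using assms by (intro positive_op_sum) (auto simp: pos_inv_def)
  then have "Re (cinner x (f j x)) \<le> Re (cinner x (sum f I x))" for x
    by (simp add: sum.remove[OF assms(1) j] blinfun.add_left cinner_add_right positive_op_iff)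
  then have "invertible_op (sum f I)"
    using pos m order_trans by (intro invertible_op_coercive[OF _ m(1)])
      (auto simp: positive_op_iff selfadj_bounded_ops intro: order_trans[OF m(2)])
  with pos show ?thesis by (simp add: pos_inv_def)
qed

lemma pos_inv_conjugate:
  assumes A: "pos_inv A" and B: "pos_inv B"
  shows "pos_inv (op_powr A u o\<^sub>L B o\<^sub>L op_powr A u)"
proof -
  have "op_powr A u o\<^sub>L op_powr A (- u) = id_blinfun" "op_powr A (- u) o\<^sub>L op_powr A u = id_blinfun"
    by (simp_all add: op_powr_zero A flip: op_powr_add)
  then have "invertible_op (op_powr A u)"
    using selfadj_bounded_ops[OF selfadj_op_powr[OF A]] by (intro invertible_opI)
  then show ?thesis
    using B positive_op_conjugate[OF selfadj_op_powr[OF A]] by (simp add: pos_inv_def invertible_op_compose)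
qed

section \<open>From scalar inequalities to weighted geometric means\<close>

lemma geo_mean_zero:
  assumes A: "pos_inv A" and B: "pos_inv B"
  shows "A \<sharp>\<^bsub>0\<^esub> B = A"
  by (simp only: geo_mean_def op_powr_zero[OF pos_inv_conjugate[OF A B]] blinfun_compose_id op_powr_half(1)[OF A])

lemma geo_mean_one:
  assumes A: "pos_inv A" and B: "pos_inv B"
  shows "A \<sharp>\<^bsub>1\<^esub> B = B"
proof -
  let ?P = "op_powr A (1/2)" and ?Q = "op_powr A (-1/2)"
  have "A \<sharp>\<^bsub>1\<^esub> B = (?P o\<^sub>L ?Q) o\<^sub>L B o\<^sub>L (?Q o\<^sub>L ?P)"
    unfolding geo_mean_def op_powr_one[OF pos_inv_conjugate[OF A B]] by (simp only: blinfun_compose_assoc)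
  then show ?thesis by (simp only: op_powr_half[OF A] blinfun_compose_id)
qed

text \<open>The transfer principle: the functional calculus of \<open>C\<close> makes the scalar
  inequality one between powers of \<open>C\<close>, and conjugation by \<open>?P\<close> turns
  these into means. A list lets exponents repeat; exponents \<open>0\<close> and \<open>1\<close>
  stand for \<open>A\<close> and \<open>B\<close>.\<close>

lemma positive_geo_mean_combination:
  assumes A: "pos_inv A" and B: "pos_inv B"
    and nonneg: "\<And>x. 0 < x \<Longrightarrow> 0 \<le> (\<Sum>(c, u)\<leftarrow>cs. c * x powr u)"
  shows "positive_op (\<Sum>(c, u)\<leftarrow>cs. c *\<^sub>R (A \<sharp>\<^bsub>u\<^esub> B))"
proof -
  let ?P = "op_powr A (1/2)"
  define C where "C = op_powr A (-1/2) o\<^sub>L B o\<^sub>L op_powr A (-1/2)"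
  have C: "pos_inv C" unfolding C_def by (rule pos_inv_conjugate[OF A B])
  note sa = pos_inv_selfadj[OF C]
  have "poly_approximable C (\<lambda>x. \<Sum>(c, u)\<leftarrow>cs. c * x powr u) \<and>
    cfc (\<lambda>x. \<Sum>(c, u)\<leftarrow>cs. c * x powr u) C = (\<Sum>(c, u)\<leftarrow>cs. c *\<^sub>R op_powr C u)"
  proof (induction cs)
    case Nil
    show ?case
      using cfc_const[OF sa, of 0] by (simp add: poly_approximable_const)
  next
    case (Cons cu cs)
    obtain c u where cu: "cu = (c, u)" by fastforce
    have 1: "poly_approximable C (\<lambda>x. c * x powr u)"
      by (intro cfc_scaleR sa poly_approximable_powr C)
    show ?case
      using Cons.IH by (simp add: cu cfc_add[OF sa 1] cfc_scaleR[OF sa poly_approximable_powr[OF C]] op_powr_def)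
  qed
  moreover have "positive_op (cfc (\<lambda>x. \<Sum>(c, u)\<leftarrow>cs. c * x powr u) C)"
    using calculation nonneg pos_inv_spectrum_pos[OF C] by (intro positive_cfc[OF sa]) auto
  ultimately have "positive_op (?P o\<^sub>L (\<Sum>(c, u)\<leftarrow>cs. c *\<^sub>R op_powr C u) o\<^sub>L ?P)"
    by (intro positive_op_conjugate selfadj_op_powr A) simp
  also have "?P o\<^sub>L (\<Sum>(c, u)\<leftarrow>cs. c *\<^sub>R op_powr C u) o\<^sub>L ?P = (\<Sum>(c, u)\<leftarrow>cs. c *\<^sub>R (A \<sharp>\<^bsub>u\<^esub> B))"
    by (induction cs) (auto simp: geo_mean_def C_def blinfun_compose.add_left blinfun_compose.add_right
      blinfun_compose.scaleR_left blinfun_compose.scaleR_right)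
  finally show ?thesis .
qed

subsection \<open>Refined Young inequalities\<close>

text \<open>Convexity of \<open>exp\<close> between \<open>0\<close> and
  \<open>ln y\<close>.\<close>

lemma powr_le_weighted_sum:
  fixes y :: real
  assumes "0 < y" "0 \<le> s" "s \<le> 1"
  shows "y powr s \<le> 1 - s + s * y"
proof -
  have "exp ((1 - s) *\<^sub>R 0 + s *\<^sub>R ln y) \<le> (1 - s) * exp 0 + s * exp (ln y)"
    using assms by (intro convex_onD[OF exp_convex]) auto
  then show ?thesis using assms by (simp add: powr_def)
qed

text \<open>With \<open>z\<close> the square root of \<open>y\<close>, subtracting the refinement
  term leaves \<open>1 - 2 * s + 2 * s * z\<close> if \<open>s \<le> 1/2\<close>, and
  \<open>z\<close> times a weighted mean of \<open>1\<close> and \<open>z\<close> otherwise. Both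
  are the plain inequality for \<open>z\<close>.\<close>

lemma powr_refined_Young:
  fixes y :: real
  assumes y: "0 < y" and s: "0 \<le> s" "s \<le> 1"
  shows "y powr s + min s (1 - s) * (1 + y - 2 * y powr (1/2)) \<le> 1 - s + s * y"
proof -
  define z where "z = y powr (1/2)"
  have z: "0 < z" and zz: "z * z = y" using y by (simp_all add: z_def flip: powr_add)
  have zs: "z powr (2 * s) = y powr s" by (simp add: z_def powr_powr)
  show ?thesis
  proof (cases "s \<le> 1/2")
    case True
    have "z powr (2 * s) \<le> 1 - 2 * s + 2 * s * z"
      using powr_le_weighted_sum[OF z, of "2 * s"] True s by simp
    then have "y powr s \<le> 1 - 2 * s + 2 * s * z" by (simp only: zs)
    then show ?thesis using True by (simp add: min_def algebra_simps flip: z_def)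
  next
    case False
    have "z powr (2 * s - 1) \<le> 2 - 2 * s + (2 * s - 1) * z"
      using powr_le_weighted_sum[OF z, of "2 * s - 1"] False s by simp
    then have "z * z powr (2 * s - 1) \<le> z * (2 - 2 * s + (2 * s - 1) * z)"
      using z by (intro mult_left_mono) auto
    also have "z * z powr (2 * s - 1) = y powr s"
      using z powr_add[of z 1 "2 * s - 1"] by (simp add: zs)
    also have "z * (2 - 2 * s + (2 * s - 1) * z) = (2 - 2 * s) * z + (2 * s - 1) * y"
      by (simp add: algebra_simps zz[symmetric])
    finally show ?thesis using False by (simp add: min_def algebra_simps flip: z_def)
  qed
qed

text \<open>The refined inequality at the square root \<open>y\<close> of \<open>x\<close> with
  exponent \<open>2 * t\<close>; what is left over is \<open>t * (1 - y)\<^sup>2\<close>.\<close>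

lemma powr_Young_lower:
  fixes x :: real
  assumes x: "0 < x" and t: "0 \<le> t" "t \<le> 1/2"
  shows "x powr t + min (2 * t) (1 - 2 * t) * (x powr (1/2) + 1 - 2 * x powr (1/4)) \<le> 1 - t + t * x"
proof -
  define y where "y = x powr (1/2)"
  have y: "0 < y" and yy: "y * y = x" using x by (simp_all add: y_def flip: powr_add)
  have "y powr (2 * t) = x powr t" "y powr (1/2) = x powr (1/4)" by (simp_all add: y_def powr_powr)
  then have "x powr t + min (2 * t) (1 - 2 * t) * (1 + y - 2 * x powr (1/4)) \<le> 1 - 2 * t + 2 * t * y"
    using powr_refined_Young[OF y, of "2 * t"] t by simp
  also have "\<dots> \<le> 1 - t + t * x"
  proof -
    have "0 \<le> t * (1 - y)\<^sup>2" using t by simp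
    then show ?thesis by (simp add: power2_eq_square algebra_simps yy[symmetric])
  qed
  finally show ?thesis by (simp add: y_def add.commute)
qed

text \<open>The refined inequality at the square root \<open>y\<close> with exponent
  \<open>1 - 2 * t\<close>, multiplied by \<open>y\<close>, bounds \<open>x powr (1 - t)\<close>
  above. Since \<open>2 * y \<le> x powr t + x powr (1 - t)\<close>, this bounds
  \<open>x powr t\<close> below.\<close>

lemma powr_Young_upper:
  fixes x :: real
  assumes x: "0 < x" and t: "0 \<le> t" "t \<le> 1/2"
  shows "1 - t + t * x + min (2 * t) (1 - 2 * t) * (x powr (1/2) + x - 2 * x powr (3/4))
    \<le> x powr t + (1 - t) * (1 + x - 2 * x powr (1/2))"
proof -
  define y where "y = x powr (1/2)"
  define m where "m = min (2 * t) (1 - 2 * t)"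
  have y: "0 < y" and yy: "y * y = x" using x by (simp_all add: y_def flip: powr_add)
  have "y powr (1 - 2 * t) + m * (1 + y - 2 * y powr (1/2)) \<le> 2 * t + (1 - 2 * t) * y"
    using powr_refined_Young[OF y, of "1 - 2 * t"] t by (simp add: m_def min.commute)
  then have "y * (y powr (1 - 2 * t) + m * (1 + y - 2 * y powr (1/2))) \<le> y * (2 * t + (1 - 2 * t) * y)"
    using y by (intro mult_left_mono) auto
  moreover have "y * (y powr (1 - 2 * t) + m * (1 + y - 2 * y powr (1/2)))
    = y * y powr (1 - 2 * t) + m * (y + y * y - 2 * (y * y powr (1/2)))"
    and "y * (2 * t + (1 - 2 * t) * y) = 2 * t * y + (1 - 2 * t) * (y * y)"
    by (simp_all only: algebra_simps)
  moreover have "y * y powr (1 - 2 * t) = x powr (1 - t)" "y * y powr (1/2) = x powr (3/4)"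
    by (simp_all add: y_def powr_powr diff_divide_distrib flip: powr_add)
  ultimately have *: "x powr (1 - t) + m * (y + x - 2 * x powr (3/4)) \<le> 2 * t * y + (1 - 2 * t) * x"
    by (simp only: yy)
  \<comment> \<open>Square roots of \<open>x powr t\<close> and \<open>x powr (1 - t)\<close>, whose
    product is \<open>y\<close>.\<close>
  define a where "a = x powr (t/2)"
  define b where "b = x powr ((1 - t)/2)"
  have "a * a = x powr t" "b * b = x powr (1 - t)" "a * b = y"
    by (simp_all add: a_def b_def y_def diff_divide_distrib flip: powr_add)
  moreover have "0 \<le> (a - b)\<^sup>2" by simp
  ultimately have "2 * y \<le> x powr t + x powr (1 - t)"
    by (simp add: power2_eq_square algebra_simps)
  with * show ?thesis unfolding m_def[symmetric] y_def[symmetric] by (simp add: algebra_simps)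
qed

text \<open>Scalar form of the symmetry that exchanges the arguments of a mean and replaces
  \<open>u\<close> by \<open>1 - u\<close>. It reduces \<open>t \<ge> 1/2\<close> to the case
  already treated.\<close>

lemma powr_reflect:
  fixes x :: real
  assumes "0 < x"
  shows "x * (1 / x) powr u = x powr (1 - u)"
  using assms by (simp add: powr_divide powr_diff)

lemma powr_Young_lower':
  fixes x :: real
  assumes x: "0 < x" and t: "1/2 \<le> t" "t \<le> 1"
  shows "x powr t + min (2 * (1 - t)) (1 - 2 * (1 - t)) * (x powr (1/2) + x - 2 * x powr (3/4))
    \<le> 1 - t + t * x"
proof -
  let ?m = "min (2 * (1 - t)) (1 - 2 * (1 - t))"
  have "(1/x) powr (1 - t) + ?m * ((1/x) powr (1/2) + 1 - 2 * (1/x) powr (1/4)) \<le> t + (1 - t) * (1/x)"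
    using powr_Young_lower[of "1/x" "1 - t"] x t by simp
  then have "x * ((1/x) powr (1 - t) + ?m * ((1/x) powr (1/2) + 1 - 2 * (1/x) powr (1/4))) \<le> x * (t + (1 - t) * (1/x))"
    using x by (intro mult_left_mono) auto
  also have "x * ((1/x) powr (1 - t) + ?m * ((1/x) powr (1/2) + 1 - 2 * (1/x) powr (1/4)))
    = x * (1/x) powr (1 - t) + ?m * (x * (1/x) powr (1/2) + x - 2 * (x * (1/x) powr (1/4)))"
    by (simp only: algebra_simps)
  also have "\<dots> = x powr t + ?m * (x powr (1/2) + x - 2 * x powr (3/4))"
    by (simp only: powr_reflect[OF x]) simp
  also have "x * (t + (1 - t) * (1/x)) = 1 - t + t * x"
    using x by (simp add: field_simps)
  finally show ?thesis .
qed

lemma powr_Young_upper':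
  fixes x :: real
  assumes x: "0 < x" and t: "1/2 \<le> t" "t \<le> 1"
  shows "1 - t + t * x + min (2 * (1 - t)) (1 - 2 * (1 - t)) * (x powr (1/2) + 1 - 2 * x powr (1/4))
    \<le> x powr t + t * (1 + x - 2 * x powr (1/2))"
proof -
  let ?m = "min (2 * (1 - t)) (1 - 2 * (1 - t))"
  let ?z = "1 / x"
  have "t + (1 - t) * ?z + ?m * (?z powr (1/2) + ?z - 2 * ?z powr (3/4))
    \<le> ?z powr (1 - t) + t * (1 + ?z - 2 * ?z powr (1/2))"
    using powr_Young_upper[of ?z "1 - t"] x t by simp
  then have "x * (t + (1 - t) * ?z + ?m * (?z powr (1/2) + ?z - 2 * ?z powr (3/4)))
    \<le> x * (?z powr (1 - t) + t * (1 + ?z - 2 * ?z powr (1/2)))"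
    using x by (intro mult_left_mono) auto
  also have "x * (t + (1 - t) * ?z + ?m * (?z powr (1/2) + ?z - 2 * ?z powr (3/4)))
    = t * x + (1 - t) * (x * ?z) + ?m * (x * ?z powr (1/2) + x * ?z - 2 * (x * ?z powr (3/4)))"
    by (simp only: algebra_simps)
  also have "\<dots> = t * x + (1 - t) + ?m * (x powr (1/2) + 1 - 2 * x powr (1/4))"
    using x by (simp only: powr_reflect[OF x]) simp
  also have "x * (?z powr (1 - t) + t * (1 + ?z - 2 * ?z powr (1/2)))
    = x * ?z powr (1 - t) + t * (x + x * ?z - 2 * (x * ?z powr (1/2)))"
    by (simp only: algebra_simps)
  also have "\<dots> = x powr t + t * (x + 1 - 2 * x powr (1/2))"
    using x by (simp only: powr_reflect[OF x]) simp
  finally show ?thesis by (simp add: algebra_simps)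
qed

section \<open>Young inequalities for one pair of operators\<close>

lemma geo_mean_Young_lower:
  assumes A: "pos_inv A" and B: "pos_inv B" and t: "0 \<le> t" "t \<le> 1/2"
    and r\<^sub>0: "r\<^sub>0 = min (2 * t) (1 - 2 * t)"
  shows "positive_op ((1 - t) *\<^sub>R A + t *\<^sub>R B - (A \<sharp>\<^bsub>t\<^esub> B)
    - r\<^sub>0 *\<^sub>R ((A \<sharp> B) + A - 2 *\<^sub>R (A \<sharp>\<^bsub>1/4\<^esub> B)))"
  using positive_geo_mean_combination[OF A B,
      of "[(1 - t, 0), (t, 1), (- 1, t), (- r\<^sub>0, 1/2), (- r\<^sub>0, 0), (2 * r\<^sub>0, 1/4)]"]
    powr_Young_lower[OF _ t, folded r\<^sub>0]
  by (simp add: geo_mean_zero[OF A B] geo_mean_one[OF A B] algebra_simps)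

lemma geo_mean_Young_upper:
  assumes A: "pos_inv A" and B: "pos_inv B" and t: "0 \<le> t" "t \<le> 1/2"
    and r\<^sub>0: "r\<^sub>0 = min (2 * t) (1 - 2 * t)"
  shows "positive_op ((A \<sharp>\<^bsub>t\<^esub> B) + (1 - t) *\<^sub>R (A + B - 2 *\<^sub>R (A \<sharp> B))
    - r\<^sub>0 *\<^sub>R ((A \<sharp> B) + B - 2 *\<^sub>R (A \<sharp>\<^bsub>3/4\<^esub> B)) - ((1 - t) *\<^sub>R A + t *\<^sub>R B))"
  \<comment> \<open>The multiples of \<open>A\<close> cancel, so exponent \<open>0\<close> does not
    occur in the list.\<close>
  using positive_geo_mean_combination[OF A B,
      of "[(1, t), (1 - t, 1), (- 2 * (1 - t), 1/2), (- r\<^sub>0, 1/2), (- r\<^sub>0, 1), (2 * r\<^sub>0, 3/4), (- t, 1)]"]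
    powr_Young_upper[OF _ t, folded r\<^sub>0]
  by (simp add: geo_mean_one[OF A B] algebra_simps)

lemma geo_mean_Young_lower':
  assumes A: "pos_inv A" and B: "pos_inv B" and t: "1/2 \<le> t" "t \<le> 1"
    and r\<^sub>0: "r\<^sub>0 = min (2 * (1 - t)) (1 - 2 * (1 - t))"
  shows "positive_op ((1 - t) *\<^sub>R A + t *\<^sub>R B - (A \<sharp>\<^bsub>t\<^esub> B)
    - r\<^sub>0 *\<^sub>R ((A \<sharp> B) + B - 2 *\<^sub>R (A \<sharp>\<^bsub>3/4\<^esub> B)))"
  using positive_geo_mean_combination[OF A B,
      of "[(1 - t, 0), (t, 1), (- 1, t), (- r\<^sub>0, 1/2), (- r\<^sub>0, 1), (2 * r\<^sub>0, 3/4)]"]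
    powr_Young_lower'[OF _ t, folded r\<^sub>0]
  by (simp add: geo_mean_zero[OF A B] geo_mean_one[OF A B] algebra_simps)

lemma geo_mean_Young_upper':
  assumes A: "pos_inv A" and B: "pos_inv B" and t: "1/2 \<le> t" "t \<le> 1"
    and r\<^sub>0: "r\<^sub>0 = min (2 * (1 - t)) (1 - 2 * (1 - t))"
  shows "positive_op ((A \<sharp>\<^bsub>t\<^esub> B) + t *\<^sub>R (A + B - 2 *\<^sub>R (A \<sharp> B))
    - r\<^sub>0 *\<^sub>R ((A \<sharp> B) + A - 2 *\<^sub>R (A \<sharp>\<^bsub>1/4\<^esub> B)) - ((1 - t) *\<^sub>R A + t *\<^sub>R B))"
  \<comment> \<open>Here the multiples of \<open>B\<close> cancel, and exponent \<open>1\<close>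
    does not occur.\<close>
  using positive_geo_mean_combination[OF A B,
      of "[(1, t), (t, 0), (- 2 * t, 1/2), (- r\<^sub>0, 1/2), (- r\<^sub>0, 0), (2 * r\<^sub>0, 1/4), (t - 1, 0)]"]
    powr_Young_upper'[OF _ t, folded r\<^sub>0]
  by (simp add: geo_mean_zero[OF A B] algebra_simps)

section \<open>Summation over the pairs\<close>

theorem theorem3p1:
  fixes A B :: "nat \<Rightarrow> ('a::chilbert_space \<Rightarrow>\<^sub>L 'a)"
    and n :: nat
    and t r R r\<^sub>0 :: real
  assumes "n \<ge> 1"
    and "\<And>i. i \<in> {1..n} \<Longrightarrow> positive_op (A i) \<and> invertible_op (A i)"
    and "\<And>i. i \<in> {1..n} \<Longrightarrow> positive_op (B i) \<and> invertible_op (B i)"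
    and "t \<in> {0..1}"
    and "r = min t (1 - t)"
    and "R = max t (1 - t)"
    and "r\<^sub>0 = min (2 * r) (1 - 2 * r)"
  shows "(0 < t \<and> t \<le> 1/2 \<longrightarrow>
      ((\<Sum>i=1..n. A i) \<sharp>\<^bsub>t\<^esub> (\<Sum>i=1..n. B i)) - (\<Sum>i=1..n. A i \<sharp>\<^bsub>t\<^esub> B i) \<le>\<^sub>o\<^sub>p
        R *\<^sub>R ((\<Sum>i=1..n. A i) + (\<Sum>i=1..n. B i) - 2 *\<^sub>R (\<Sum>i=1..n. A i \<sharp> B i))
        - r\<^sub>0 *\<^sub>R ((\<Sum>i=1..n. A i \<sharp> B i) + (\<Sum>i=1..n. B i)
            - 2 *\<^sub>R (\<Sum>i=1..n. A i \<sharp>\<^bsub>3/4\<^esub> B i))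
        - r\<^sub>0 *\<^sub>R (((\<Sum>i=1..n. A i) \<sharp> (\<Sum>i=1..n. B i)) + (\<Sum>i=1..n. A i)
            - 2 *\<^sub>R ((\<Sum>i=1..n. A i) \<sharp>\<^bsub>1/4\<^esub> (\<Sum>i=1..n. B i))))
    \<and> (1/2 < t \<and> t < 1 \<longrightarrow>
      ((\<Sum>i=1..n. A i) \<sharp>\<^bsub>t\<^esub> (\<Sum>i=1..n. B i)) - (\<Sum>i=1..n. A i \<sharp>\<^bsub>t\<^esub> B i) \<le>\<^sub>o\<^sub>p
        R *\<^sub>R ((\<Sum>i=1..n. A i) + (\<Sum>i=1..n. B i) - 2 *\<^sub>R (\<Sum>i=1..n. A i \<sharp> B i))
        - r\<^sub>0 *\<^sub>R (((\<Sum>i=1..n. A i) \<sharp> (\<Sum>i=1..n. B i)) + (\<Sum>i=1..n. B i)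
            - 2 *\<^sub>R ((\<Sum>i=1..n. A i) \<sharp>\<^bsub>3/4\<^esub> (\<Sum>i=1..n. B i)))
        - r\<^sub>0 *\<^sub>R ((\<Sum>i=1..n. A i \<sharp> B i) + (\<Sum>i=1..n. A i)
            - 2 *\<^sub>R (\<Sum>i=1..n. A i \<sharp>\<^bsub>1/4\<^esub> B i)))"
proof -
  have A: "pos_inv (A i)" and B: "pos_inv (B i)" if "i \<in> {1..n}" for i
    using assms(2,3)[OF that] by (simp_all add: pos_inv_def)
  have SA: "pos_inv (\<Sum>i=1..n. A i)" and SB: "pos_inv (\<Sum>i=1..n. B i)"
    using assms(1) by (auto intro!: pos_inv_sum A B)
  let ?A = "\<Sum>i=1..n. A i" and ?B = "\<Sum>i=1..n. B i"
  show ?thesis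
  proof (intro conjI impI)
    assume "0 < t \<and> t \<le> 1/2"
    then have t: "0 \<le> t" "t \<le> 1/2" and R: "R = 1 - t" and r\<^sub>0: "r\<^sub>0 = min (2 * t) (1 - 2 * t)"
      using assms(5-7) by auto
    have "positive_op (\<Sum>i=1..n. (A i \<sharp>\<^bsub>t\<^esub> B i) + (1 - t) *\<^sub>R (A i + B i - 2 *\<^sub>R (A i \<sharp> B i))
      - r\<^sub>0 *\<^sub>R ((A i \<sharp> B i) + B i - 2 *\<^sub>R (A i \<sharp>\<^bsub>3/4\<^esub> B i)) - ((1 - t) *\<^sub>R A i + t *\<^sub>R B i))"
      by (intro positive_op_sum geo_mean_Young_upper A B t r\<^sub>0)
    \<comment> \<open>In the sum of the two positive operators the arithmetic mean of
      \<open>?A\<close> and \<open>?B\<close> cancels; regrouping gives right side minus left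
      side.\<close>
    from positive_op_add[OF geo_mean_Young_lower[OF SA SB t r\<^sub>0] this]
    show "(?A \<sharp>\<^bsub>t\<^esub> ?B) - (\<Sum>i=1..n. A i \<sharp>\<^bsub>t\<^esub> B i) \<le>\<^sub>o\<^sub>p
        R *\<^sub>R (?A + ?B - 2 *\<^sub>R (\<Sum>i=1..n. A i \<sharp> B i))
        - r\<^sub>0 *\<^sub>R ((\<Sum>i=1..n. A i \<sharp> B i) + ?B - 2 *\<^sub>R (\<Sum>i=1..n. A i \<sharp>\<^bsub>3/4\<^esub> B i))
        - r\<^sub>0 *\<^sub>R ((?A \<sharp> ?B) + ?A - 2 *\<^sub>R (?A \<sharp>\<^bsub>1/4\<^esub> ?B))"
      unfolding op_le_def R
      by (elim back_subst[of positive_op])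
        (simp only: sum.distrib sum_subtractf scaleR_sum_right[symmetric], simp only: algebra_simps)
  next
    assume "1/2 < t \<and> t < 1"
    \<comment> \<open>Now \<open>r = 1 - t\<close>, and the reflected inequalities swap the roles of
      the exponents \<open>1/4\<close> and \<open>3/4\<close>.\<close>
    then have t: "1/2 \<le> t" "t \<le> 1" and R: "R = t" and r\<^sub>0: "r\<^sub>0 = min (2 * (1 - t)) (1 - 2 * (1 - t))"
      using assms(5-7) by auto
    have "positive_op (\<Sum>i=1..n. (A i \<sharp>\<^bsub>t\<^esub> B i) + t *\<^sub>R (A i + B i - 2 *\<^sub>R (A i \<sharp> B i))
      - r\<^sub>0 *\<^sub>R ((A i \<sharp> B i) + A i - 2 *\<^sub>R (A i \<sharp>\<^bsub>1/4\<^esub> B i)) - ((1 - t) *\<^sub>R A i + t *\<^sub>R B i))"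
      by (intro positive_op_sum geo_mean_Young_upper' A B t r\<^sub>0)
    from positive_op_add[OF geo_mean_Young_lower'[OF SA SB t r\<^sub>0] this]
    show "(?A \<sharp>\<^bsub>t\<^esub> ?B) - (\<Sum>i=1..n. A i \<sharp>\<^bsub>t\<^esub> B i) \<le>\<^sub>o\<^sub>p
        R *\<^sub>R (?A + ?B - 2 *\<^sub>R (\<Sum>i=1..n. A i \<sharp> B i))
        - r\<^sub>0 *\<^sub>R ((?A \<sharp> ?B) + ?B - 2 *\<^sub>R (?A \<sharp>\<^bsub>3/4\<^esub> ?B))
        - r\<^sub>0 *\<^sub>R ((\<Sum>i=1..n. A i \<sharp> B i) + ?A - 2 *\<^sub>R (\<Sum>i=1..n. A i \<sharp>\<^bsub>1/4\<^esub> B i))"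
      unfolding op_le_def R
      by (elim back_subst[of positive_op])
        (simp only: sum.distrib sum_subtractf scaleR_sum_right[symmetric], simp only: algebra_simps)
  qed
qed

end
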